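(* Let $d=2$ and take the Euclidean norm as reference norm, so that $\mathbb{S}=\mathbb{S}^1_+=\{x\in[0,\infty)^2: x_1^2+x_2^2=1\}$. A finite measure $\sigma$ on $\mathbb{S}^1_+$ is the spectral measure of a simple max-stable random vector with dependency set $K$ if and only if both of the following hold: - $K$ is a compact convex set with $\mathrm{conv}\{0,e_1,e_2\}\subset K\subset[0,1]^2$; - $\sigma$ is the restriction to $\mathbb{S}^1_+$ of the length measure $S_1(\check K,\cdot)$, where $\check K=\{(x_1,x_2):(x_2,x_1)\in K\}$.
   Context: For a planar compact convex set $L$, the length measure $S_1(L,\cdot)$ is the Borel measure on the unit circle that assigns to a Borel set $A$ the one-dimensional Hausdorff measure of the set of boundary points of $L$ having an outer unit normal vector in $A$. This is the first-order surface area measure of convex geometry. A simple max-stable random vector $\xi$ is max-stable with unit Fréchet marginals, $\mathbb{P}\{\xi_i\le t\}=e^{-1/t}$ for $t>0$. It has cumulative distribution function $\mathbb{P}\{\xi\le x\}=\exp\{-\int_{\mathbb{S}}\max_i(a_i/x_i)\,\sigma(da)\}$, $x\in(0,\infty)^2$, for a unique finite measure $\sigma$ on $\mathbb{S}$ with $\int a_i\,\sigma(da)=1$, called its spectral measure. Its dependency set $K$ is the compact convex set with support function $h(K,x)=\sup_{y\in K}\langle y,x\rangle=\int_{\mathbb{S}}\max_i(a_ix_i)\,\sigma(da)$, $x\in[0,\infty)^2$. *)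

theory Defs
  imports "HOL-Analysis.Analysis" "HOL-Probability.Probability"
begin

definition orthant :: "(real \<times> real) set" where
  "orthant = {x. 0 \<le> fst x \<and> 0 \<le> snd x}"

definition S1p :: "(real \<times> real) set" where
  "S1p = {x. 0 \<le> fst x \<and> 0 \<le> snd x \<and> (fst x)\<^sup>2 + (snd x)\<^sup>2 = 1}"

definition support_fun :: "(real \<times> real) set \<Rightarrow> real \<times> real \<Rightarrow> real" where
  "support_fun K x = (SUP y\<in>K. inner y x)"

definition flipset :: "(real \<times> real) set \<Rightarrow> (real \<times> real) set" where
  "flipset K = {x. (snd x, fst x) \<in> K}"

definition hausdorff1_pre :: "real \<Rightarrow> (real \<times> real) set \<Rightarrow> ennreal" where
  "hausdorff1_pre \<delta> E =
     (INF C\<in>{C :: nat \<Rightarrow> (real \<times> real) set.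
               E \<subseteq> (\<Union>i. C i) \<and> (\<forall>i. bounded (C i) \<and> diameter (C i) \<le> \<delta>)}.
        (\<Sum>i. ennreal (diameter (C i))))"

definition hausdorff1 :: "(real \<times> real) set \<Rightarrow> ennreal" where
  "hausdorff1 E = (SUP \<delta>\<in>{0<..}. hausdorff1_pre \<delta> E)"

definition outer_unit_normal :: "(real \<times> real) set \<Rightarrow> real \<times> real \<Rightarrow> real \<times> real \<Rightarrow> bool" where
  "outer_unit_normal L x u \<longleftrightarrow> norm u = 1 \<and> (\<forall>y\<in>L. inner y u \<le> inner x u)"

definition length_measure :: "(real \<times> real) set \<Rightarrow> (real \<times> real) set \<Rightarrow> ennreal" where
  "length_measure L A = hausdorff1 {x \<in> frontier L. \<exists>u\<in>A. outer_unit_normal L x u}"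

definition cdf2 :: "(real \<times> real) measure \<Rightarrow> real \<times> real \<Rightarrow> real" where
  "cdf2 \<mu> x = measure \<mu> {y. fst y \<le> fst x \<and> snd y \<le> snd x}"

text \<open>Simple max-stable distribution: unit Frechet marginals and max-stability
  (the maximum of n i.i.d. copies divided by n has the same distribution).\<close>
definition simple_max_stable :: "(real \<times> real) measure \<Rightarrow> bool" where
  "simple_max_stable \<mu> \<longleftrightarrow>
     prob_space \<mu> \<and> sets \<mu> = sets borel \<and>
     (\<forall>t>0. measure \<mu> {y. fst y \<le> t} = exp (- 1 / t)) \<and>
     (\<forall>t>0. measure \<mu> {y. snd y \<le> t} = exp (- 1 / t)) \<and>
     (\<forall>n::nat. n \<ge> 1 \<longrightarrow> (\<forall>x. (cdf2 \<mu> (real n *\<^sub>R x)) ^ n = cdf2 \<mu> x))"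

definition is_spectral_measure :: "(real \<times> real) measure \<Rightarrow> (real \<times> real) measure \<Rightarrow> bool" where
  "is_spectral_measure \<mu> \<sigma> \<longleftrightarrow>
     finite_measure \<sigma> \<and> sets \<sigma> = sets (restrict_space borel S1p) \<and>
     integral\<^sup>L \<sigma> fst = 1 \<and> integral\<^sup>L \<sigma> snd = 1 \<and>
     (\<forall>x. 0 < fst x \<and> 0 < snd x \<longrightarrow>
        cdf2 \<mu> x = exp (- (\<integral>a. max (fst a / fst x) (snd a / snd x) \<partial>\<sigma>)))"

definition is_dependency_set :: "(real \<times> real) measure \<Rightarrow> (real \<times> real) set \<Rightarrow> bool" where
  "is_dependency_set \<sigma> K \<longleftrightarrow>
     compact K \<and> convex K \<and> K \<noteq> {} \<and> K \<subseteq> orthant \<and>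
     (\<forall>x\<in>orthant. support_fun K x = (\<integral>a. max (fst a * fst x) (snd a * snd x) \<partial>\<sigma>)) \<and>
     (\<forall>L. compact L \<and> convex L \<and> L \<noteq> {} \<and> L \<subseteq> orthant \<and>
          (\<forall>x\<in>orthant. support_fun L x = support_fun K x) \<longrightarrow> L \<subseteq> K)"

definition spectral_measure_with_dependency_set ::
    "(real \<times> real) measure \<Rightarrow> (real \<times> real) set \<Rightarrow> bool" where
  "spectral_measure_with_dependency_set \<sigma> K \<longleftrightarrow>
     (\<exists>\<mu>. simple_max_stable \<mu> \<and> is_spectral_measure \<mu> \<sigma>) \<and> is_dependency_set \<sigma> K"

end

theory Submission
  imports Defs
begin

text \<open>The function \<open>max (a\<^sub>1 x\<^sub>1) (a\<^sub>2 x\<^sub>2)\<close> is the support function of the segment from \<open>(a\<^sub>1, 0)\<close> to \<open>(0, a\<^sub>2)\<close>,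
  which has length 1 and unit normal \<open>(a\<^sub>2, a\<^sub>1)\<close> when \<open>a\<close> lies on the unit circle; so \<open>K\<close> is an integral
  of such segments, and \<open>\<sigma>\<close> distributes boundary length over the (reflected) normals.

  Conversely, let \<open>L\<close> be the reflection of \<open>K\<close>. Rotating by 45 degrees turns its upper right boundary arc
  into a concave graph. Pushing the arc length forward under the normal map gives a measure \<open>\<tau>\<close> on the
  arc of directions; the total length of the arc is at least its inscribed polygons' lengths, whence
  \<open>\<tau>\<close> is the length measure of \<open>L\<close>, and integrating along the arc up to, and beyond, the maximiser of a
  linear functional identifies the support function of \<open>K\<close> with \<open>\<integral> max (a\<^sub>1 x\<^sub>1) (a\<^sub>2 x\<^sub>2) d\<tau>\<close>. Such an
  integral determines the measure (differentiate in \<open>x\<^sub>2\<close>), so \<open>\<sigma> = \<tau>\<close> in either direction. A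
  max-stable vector with a prescribed spectral measure is obtained by sampling the first coordinate
  and then the second one from its conditional distribution. The set \<open>K\<close> is the largest one with its
  support function on the quadrant exactly when it contains \<open>0\<close>, \<open>e\<^sub>1\<close> and \<open>e\<^sub>2\<close>.\<close>

section \<open>One-dimensional Hausdorff measure\<close>

text \<open>\<open>hausdorff1\<close> is given only through covers, so additivity on Borel sets is
  not at hand. Three facts suffice: subadditivity for two sets, superadditivity for sets at positive
  distance, and a curve being at least as long as its chord. The frame turned by 45 degrees is
  chosen because normals in the closed quadrant correspond to slopes in [-1,1]: the graph is
  Lipschitz even where the body has horizontal or vertical sides. Its slope \<open>G\<close> may
  jump, so nothing is differentiated; two quantities are compared through increments that differ by
  at most t - s times an increment of a fixed function, an error that vanishes under subdivision.
  The same estimate later integrates the density behind the max-stable vector. Inside the parameter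
  interval, jumps of \<open>G\<close> come from corners of the body, where a point has many normals.
  They are countable and carry no length, so fixing one normal per parameter loses nothing.\<close>

lemma hausdorff1_pre_le:
  assumes "E \<subseteq> (\<Union>i. C i)" "\<And>i. bounded (C i)" "\<And>i. diameter (C i) \<le> \<delta>"
  shows "hausdorff1_pre \<delta> E \<le> (\<Sum>i. ennreal (diameter (C i)))"
  unfolding hausdorff1_pre_def using assms by (intro INF_lower) auto

lemma hausdorff1_pre_geI:
  assumes "\<And>C :: nat \<Rightarrow> (real \<times> real) set. E \<subseteq> (\<Union>i. C i) \<Longrightarrow> (\<And>i. bounded (C i)) \<Longrightarrow>
     (\<And>i. diameter (C i) \<le> \<delta>) \<Longrightarrow> z \<le> (\<Sum>i. ennreal (diameter (C i)))"
  shows "z \<le> hausdorff1_pre \<delta> E"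
  unfolding hausdorff1_pre_def using assms by (intro INF_greatest) auto

text \<open>Adapts sequences of sets to the countable families of intervals that a covering theorem
  delivers. Indices left over are filled with the empty set, of diameter 0.\<close>

lemma hausdorff1_pre_le_countable:
  assumes "countable I" "E \<subseteq> (\<Union>i\<in>I. C i)" "\<And>i. i \<in> I \<Longrightarrow> bounded (C i)"
    and "\<And>i. i \<in> I \<Longrightarrow> diameter (C i) \<le> \<delta>" "\<delta> > 0"
  shows "hausdorff1_pre \<delta> E \<le> (\<integral>\<^sup>+ i. ennreal (diameter (C i)) \<partial>count_space I)"
proof -
  define J where "J = to_nat_on I ` I"
  have bij: "bij_betw (from_nat_into I) J I"
    by (rule bij_betw_byWitness[where f' = "to_nat_on I"]) (use assms(1) in \<open>auto simp: J_def\<close>)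
  define C' where "C' n = (if n \<in> J then C (from_nat_into I n) else {})" for n
  have "hausdorff1_pre \<delta> E \<le> (\<Sum>n. ennreal (diameter (C' n)))"
  proof (rule hausdorff1_pre_le)
    show "E \<subseteq> (\<Union>i. C' i)"
    proof
      fix x assume "x \<in> E"
      then obtain i where i: "i \<in> I" "x \<in> C i" using assms(2) by auto
      then have "x \<in> C' (to_nat_on I i)"
        using assms(1) by (auto simp: C'_def J_def)
      then show "x \<in> (\<Union>i. C' i)" by auto
    qed
    have *: "from_nat_into I n \<in> I" if "n \<in> J" for n
      using that assms(1) by (auto simp: J_def)
    show "bounded (C' n)" for n using * assms(3) by (auto simp: C'_def)
    show "diameter (C' n) \<le> \<delta>" for n using * assms(4,5) by (auto simp: C'_def)
  qed
  also have "\<dots> = (\<integral>\<^sup>+ n. ennreal (diameter (C' n)) \<partial>count_space UNIV)"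
    by (simp add: nn_integral_count_space_nat)
  also have "\<dots> = (\<integral>\<^sup>+ n. ennreal (diameter (C (from_nat_into I n))) * indicator J n \<partial>count_space UNIV)"
    by (intro nn_integral_cong) (auto simp: C'_def)
  also have "\<dots> = (\<integral>\<^sup>+ n. ennreal (diameter (C (from_nat_into I n))) \<partial>count_space J)"
    using nn_integral_count_space_indicator[of J "\<lambda>n. ennreal (diameter (C (from_nat_into I n)))"]
    by (cases "J = UNIV") (simp_all add: nn_integral_restrict_space[symmetric] restrict_count_space)
  also have "\<dots> = (\<integral>\<^sup>+ i. ennreal (diameter (C i)) \<partial>count_space I)"
    by (rule nn_integral_bij_count_space[OF bij])
  finally show ?thesis .
qed

lemma hausdorff1_pre_antimono:
  assumes "\<delta> \<le> \<delta>'" shows "hausdorff1_pre \<delta>' E \<le> hausdorff1_pre \<delta> E"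
  by (rule hausdorff1_pre_geI, rule hausdorff1_pre_le) (use assms order_trans in blast)+

lemma hausdorff1_pre_mono: "E \<subseteq> F \<Longrightarrow> hausdorff1_pre \<delta> E \<le> hausdorff1_pre \<delta> F"
  by (rule hausdorff1_pre_geI, rule hausdorff1_pre_le) (use order_trans in blast)+

lemma hausdorff1_mono: "E \<subseteq> F \<Longrightarrow> hausdorff1 E \<le> hausdorff1 F"
  unfolding hausdorff1_def by (intro SUP_mono) (auto intro: hausdorff1_pre_mono)

lemma hausdorff1_pre_le_hausdorff1: "\<delta> > 0 \<Longrightarrow> hausdorff1_pre \<delta> E \<le> hausdorff1 E"
  unfolding hausdorff1_def by (intro SUP_upper) auto

text \<open>Passes from pairs of covers to the sum of the two infima: if both are finite, each is
  attained up to e/2 by a single cover.\<close>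

lemma ennreal_le_hausdorff1_pre_add:
  assumes "\<And>C D :: nat \<Rightarrow> (real \<times> real) set. E \<subseteq> (\<Union>i. C i) \<Longrightarrow> (\<And>i. bounded (C i)) \<Longrightarrow>
     (\<And>i. diameter (C i) \<le> \<delta>) \<Longrightarrow> F \<subseteq> (\<Union>i. D i) \<Longrightarrow> (\<And>i. bounded (D i)) \<Longrightarrow>
     (\<And>i. diameter (D i) \<le> \<delta>) \<Longrightarrow> z \<le> (\<Sum>i. ennreal (diameter (C i))) + (\<Sum>i. ennreal (diameter (D i)))"
    and "\<delta> > 0"
  shows "z \<le> hausdorff1_pre \<delta> E + hausdorff1_pre \<delta> F"
proof (rule ennreal_le_epsilon)
  fix e :: real
  assume "hausdorff1_pre \<delta> E + hausdorff1_pre \<delta> F < \<top>" and "0 < e"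
  then have fin: "hausdorff1_pre \<delta> E < \<top>" "hausdorff1_pre \<delta> F < \<top>"
    by (auto simp: less_top)
  have ex: "\<exists>C :: nat \<Rightarrow> (real \<times> real) set. G \<subseteq> (\<Union>i. C i) \<and> (\<forall>i. bounded (C i)) \<and>
     (\<forall>i. diameter (C i) \<le> \<delta>) \<and> (\<Sum>i. ennreal (diameter (C i))) < hausdorff1_pre \<delta> G + ennreal (e/2)"
    if "hausdorff1_pre \<delta> G < \<top>" for G
  proof -
    have "hausdorff1_pre \<delta> G < hausdorff1_pre \<delta> G + ennreal (e/2)"
      using that \<open>0 < e\<close> by (simp add: ennreal_add_left_cancel_less less_top[symmetric])
    then show ?thesis
      unfolding hausdorff1_pre_def[of \<delta> G] INF_less_iff by auto
  qed
  obtain C where C: "E \<subseteq> (\<Union>i. C i)" "\<And>i. bounded (C i)" "\<And>i. diameter (C i) \<le> \<delta>"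
     "(\<Sum>i. ennreal (diameter (C i))) < hausdorff1_pre \<delta> E + ennreal (e/2)" using ex[OF fin(1)] by blast
  obtain D where D: "F \<subseteq> (\<Union>i. D i)" "\<And>i. bounded (D i)" "\<And>i. diameter (D i) \<le> \<delta>"
     "(\<Sum>i. ennreal (diameter (D i))) < hausdorff1_pre \<delta> F + ennreal (e/2)" using ex[OF fin(2)] by blast
  have "z \<le> (\<Sum>i. ennreal (diameter (C i))) + (\<Sum>i. ennreal (diameter (D i)))"
    by (rule assms(1)) (use C D in auto)
  also have "\<dots> \<le> (hausdorff1_pre \<delta> E + ennreal (e/2)) + (hausdorff1_pre \<delta> F + ennreal (e/2))"
    using C D by (intro add_mono) auto
  also have "\<dots> = hausdorff1_pre \<delta> E + hausdorff1_pre \<delta> F + (ennreal (e/2) + ennreal (e/2))"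
    by (simp only: ac_simps)
  also have "ennreal (e/2) + ennreal (e/2) = ennreal e"
    using \<open>0 < e\<close> ennreal_plus[of "e/2" "e/2"] by simp
  finally show "z \<le> hausdorff1_pre \<delta> E + hausdorff1_pre \<delta> F + ennreal e" .
qed

lemma hausdorff1_subadd: "hausdorff1 (E \<union> F) \<le> hausdorff1 E + hausdorff1 F"
proof -
  have "hausdorff1_pre \<delta> (E \<union> F) \<le> hausdorff1_pre \<delta> E + hausdorff1_pre \<delta> F" if "\<delta> > 0" for \<delta>
  proof (rule ennreal_le_hausdorff1_pre_add[OF _ that])
    fix C D :: "nat \<Rightarrow> (real \<times> real) set"
    assume CD: "E \<subseteq> (\<Union>i. C i)" "\<And>i. bounded (C i)" "\<And>i. diameter (C i) \<le> \<delta>"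
      "F \<subseteq> (\<Union>i. D i)" "\<And>i. bounded (D i)" "\<And>i. diameter (D i) \<le> \<delta>"
    \<comment> \<open>The covers are interleaved, even indices for \<open>E\<close> and odd ones for
      \<open>F\<close>; the first 2n terms then split into n terms of each.\<close>
    define H where "H n = (if even n then C (n div 2) else D (n div 2))" for n
    have H: "H (2*i) = C i" "H (Suc (2*i)) = D i" for i by (auto simp: H_def)
    have "hausdorff1_pre \<delta> (E \<union> F) \<le> (\<Sum>i. ennreal (diameter (H i)))"
    proof (rule hausdorff1_pre_le)
      show "E \<union> F \<subseteq> (\<Union>i. H i)"
      proof
        fix x assume "x \<in> E \<union> F"
        then obtain i where "x \<in> C i \<or> x \<in> D i" using CD(1,4) by blast
        then have "x \<in> H (2*i) \<or> x \<in> H (Suc (2*i))" unfolding H .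
        then show "x \<in> (\<Union>i. H i)" by blast
      qed
    qed (use CD in \<open>auto simp: H_def\<close>)
    also have "\<dots> \<le> (\<Sum>i. ennreal (diameter (C i))) + (\<Sum>i. ennreal (diameter (D i)))"
    proof (rule suminf_le_const)
      fix n
      have "(\<Sum>i<n. ennreal (diameter (H i))) \<le> (\<Sum>i<2*n. ennreal (diameter (H i)))"
        by (intro sum_mono2) auto
      also have "\<dots> = (\<Sum>i<n. ennreal (diameter (C i))) + (\<Sum>i<n. ennreal (diameter (D i)))"
        by (induction n) (simp_all add: H[unfolded mult.commute[of 2]] mult.commute[of 2] add.assoc add.left_commute)
      also have "\<dots> \<le> (\<Sum>i. ennreal (diameter (C i))) + (\<Sum>i. ennreal (diameter (D i)))"
        by (intro add_mono sum_le_suminf) auto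
      finally show "(\<Sum>i<n. ennreal (diameter (H i))) \<le> \<dots>" .
    qed auto
    finally show "hausdorff1_pre \<delta> (E \<union> F) \<le> \<dots>" .
  qed
  then show ?thesis
    unfolding hausdorff1_def[of "E \<union> F"]
    by (intro SUP_least order_trans[OF _ add_mono[OF hausdorff1_pre_le_hausdorff1 hausdorff1_pre_le_hausdorff1]]) auto
qed

text \<open>A set of diameter below \<open>d\<close> cannot meet both \<open>E\<close> and
  \<open>F\<close>, so a fine cover of the union splits into a cover of each without sharing a
  set.\<close>

lemma hausdorff1_add_separated:
  assumes "d > 0" and sep: "\<And>x y. x \<in> E \<Longrightarrow> y \<in> F \<Longrightarrow> d \<le> dist x y"
  shows "hausdorff1 E + hausdorff1 F \<le> hausdorff1 (E \<union> F)"
proof -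
  have pre: "hausdorff1_pre \<delta> E + hausdorff1_pre \<delta> F \<le> hausdorff1_pre \<delta> (E \<union> F)" if "0 < \<delta>" "\<delta> < d" for \<delta>
  proof (rule hausdorff1_pre_geI)
    fix C :: "nat \<Rightarrow> (real \<times> real) set"
    assume C: "E \<union> F \<subseteq> (\<Union>i. C i)" "\<And>i. bounded (C i)" "\<And>i. diameter (C i) \<le> \<delta>"
    define A where "A i = (if C i \<inter> E = {} then {} else C i)" for i
    define B where "B i = (if C i \<inter> F = {} then {} else C i)" for i
    have le: "ennreal (diameter (A i)) + ennreal (diameter (B i)) \<le> ennreal (diameter (C i))" for i
    proof -
      have "C i \<inter> E = {} \<or> C i \<inter> F = {}"
      proof (rule ccontr)
        assume "\<not> ?thesis"
        then obtain x y where xy: "x \<in> C i" "x \<in> E" "y \<in> C i" "y \<in> F" by auto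
        have "d \<le> diameter (C i)"
          using diameter_bounded_bound[OF C(2) xy(1,3)] sep[OF xy(2,4)] by simp
        with C(3)[of i] that show False by simp
      qed
      then show ?thesis by (auto simp: A_def B_def)
    qed
    have "hausdorff1_pre \<delta> E + hausdorff1_pre \<delta> F
        \<le> (\<Sum>i. ennreal (diameter (A i))) + (\<Sum>i. ennreal (diameter (B i)))"
    proof (intro add_mono hausdorff1_pre_le)
      show "E \<subseteq> (\<Union>i. A i)" "F \<subseteq> (\<Union>i. B i)" using C(1) by (fastforce simp: A_def B_def)+
    qed (use C that in \<open>auto simp: A_def B_def\<close>)
    also have "\<dots> = (\<Sum>i. ennreal (diameter (A i)) + ennreal (diameter (B i)))"
      by (intro suminf_add) auto
    also have "\<dots> \<le> (\<Sum>i. ennreal (diameter (C i)))" by (intro suminf_le le) auto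
    finally show "hausdorff1_pre \<delta> E + hausdorff1_pre \<delta> F \<le> \<dots>" .
  qed
  \<comment> \<open>Both premeasures grow as \<delta> shrinks, so the two suprema may be taken along
    a common \<delta>.\<close>
  have "hausdorff1 E + hausdorff1 F = (SUP \<delta>\<in>{0<..}. hausdorff1_pre \<delta> E + hausdorff1_pre \<delta> F)"
    unfolding hausdorff1_def
  proof (rule SUP_add_directed_ennreal[symmetric])
    fix i j :: real assume "i \<in> {0<..}" "j \<in> {0<..}"
    then show "\<exists>k\<in>{0<..}. hausdorff1_pre i E + hausdorff1_pre j F \<le> hausdorff1_pre k E + hausdorff1_pre k F"
      by (intro bexI[of _ "min i j"] add_mono hausdorff1_pre_antimono) auto
  qed
  also have "\<dots> \<le> hausdorff1 (E \<union> F)"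
  proof (rule SUP_least)
    fix \<delta> :: real assume \<delta>: "\<delta> \<in> {0<..}"
    define k where "k = min \<delta> (d/2)"
    have k: "0 < k" "k < d" "k \<le> \<delta>" using \<delta> \<open>d > 0\<close> by (auto simp: k_def min_def)
    have "hausdorff1_pre \<delta> E + hausdorff1_pre \<delta> F \<le> hausdorff1_pre k E + hausdorff1_pre k F"
      by (intro add_mono hausdorff1_pre_antimono k)
    also have "\<dots> \<le> hausdorff1_pre k (E \<union> F)" by (rule pre[OF k(1,2)])
    also have "\<dots> \<le> hausdorff1 (E \<union> F)" by (rule hausdorff1_pre_le_hausdorff1[OF k(1)])
    finally show "hausdorff1_pre \<delta> E + hausdorff1_pre \<delta> F \<le> \<dots>" .
  qed
  finally show ?thesis .
qed

text \<open>Project to the line through the end points: the projection \<open>f\<close> is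
  1-Lipschitz and, by the intermediate value theorem, the image of the curve contains an interval as
  long as the chord. Lebesgue measure on that line then bounds every cover from below.\<close>

lemma hausdorff1_ge_dist:
  fixes \<gamma> :: "real \<Rightarrow> real \<times> real"
  assumes cont: "continuous_on {s..t} \<gamma>" and "s \<le> t"
  shows "ennreal (dist (\<gamma> s) (\<gamma> t)) \<le> hausdorff1 (\<gamma> ` {s..t})"
proof (cases "\<gamma> s = \<gamma> t")
  case False
  define w where "w = (\<gamma> t - \<gamma> s) /\<^sub>R norm (\<gamma> t - \<gamma> s)"
  have nw: "norm w = 1" using False by (simp add: w_def)
  define f where "f x = inner x w" for x :: "real \<times> real"
  have flip: "\<bar>f x - f y\<bar> \<le> dist x y" for x y
    using Cauchy_Schwarz_ineq2[of "x - y" w] nw by (simp add: f_def dist_norm inner_diff_left)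
  have fd: "f (\<gamma> t) - f (\<gamma> s) = dist (\<gamma> s) (\<gamma> t)"
  proof -
    have "f (\<gamma> t) - f (\<gamma> s) = inner (\<gamma> t - \<gamma> s) (\<gamma> t - \<gamma> s) / norm (\<gamma> t - \<gamma> s)"
      by (simp add: f_def w_def inner_diff_left divide_inverse right_diff_distrib mult.commute)
    also have "\<dots> = norm (\<gamma> t - \<gamma> s)" using False by (simp add: dot_square_norm power2_eq_square)
    finally show ?thesis by (simp add: dist_norm norm_minus_commute)
  qed
  have sub: "{f (\<gamma> s)..f (\<gamma> t)} \<subseteq> f ` \<gamma> ` {s..t}"
  proof
    fix y assume "y \<in> {f (\<gamma> s)..f (\<gamma> t)}"
    moreover have "continuous_on {s..t} (\<lambda>x. f (\<gamma> x))"
      unfolding f_def by (intro continuous_intros cont)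
    ultimately obtain x where "s \<le> x" "x \<le> t" "f (\<gamma> x) = y"
      using IVT'[of "\<lambda>x. f (\<gamma> x)" s y t] \<open>s \<le> t\<close> by auto
    then show "y \<in> f ` \<gamma> ` {s..t}" by auto
  qed
  have "ennreal (dist (\<gamma> s) (\<gamma> t)) \<le> hausdorff1_pre 1 (\<gamma> ` {s..t})"
  proof (rule hausdorff1_pre_geI)
    fix C :: "nat \<Rightarrow> (real \<times> real) set"
    assume C: "\<gamma> ` {s..t} \<subseteq> (\<Union>i. C i)" "\<And>i. bounded (C i)" "\<And>i. diameter (C i) \<le> 1"
    \<comment> \<open>The sets \<open>C i\<close> are arbitrary; the closed interval spanned by the
      projection is measurable and still no longer than the diameter.\<close>
    define J where "J i = (if C i = {} then {} else {Inf (f ` C i)..Sup (f ` C i)})" for i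
    have bd: "bdd_above (f ` C i)" "bdd_below (f ` C i)" for i
    proof -
      have "bounded (f ` C i)" unfolding f_def
        by (intro bounded_linear_image[OF C(2)] bounded_linear_inner_left)
      then show "bdd_above (f ` C i)" "bdd_below (f ` C i)"
        by (auto intro: bounded_imp_bdd_above bounded_imp_bdd_below)
    qed
    have len: "emeasure lborel (J i) \<le> ennreal (diameter (C i))" for i
    proof (cases "C i = {}")
      case False
      have "Sup (f ` C i) \<le> Inf (f ` C i) + diameter (C i)"
      proof (rule cSup_least)
        fix a assume "a \<in> f ` C i"
        then obtain x where x: "x \<in> C i" "a = f x" by auto
        have "a - diameter (C i) \<le> Inf (f ` C i)"
        proof (rule cInf_greatest)
          fix b assume "b \<in> f ` C i"
          then obtain y where y: "y \<in> C i" "b = f y" by auto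
          show "a - diameter (C i) \<le> b"
            using diameter_bounded_bound[OF C(2) x(1) y(1)] flip[of x y] x y by simp
        qed (use False in auto)
        then show "a \<le> Inf (f ` C i) + diameter (C i)" by simp
      qed (use False in auto)
      moreover have "Inf (f ` C i) \<le> Sup (f ` C i)"
        using False bd by (intro cInf_le_cSup) auto
      ultimately show ?thesis using False by (auto simp: J_def intro!: ennreal_leI)
    qed (simp add: J_def)
    have "ennreal (dist (\<gamma> s) (\<gamma> t)) = emeasure lborel {f (\<gamma> s)..f (\<gamma> t)}"
      using zero_le_dist[of "\<gamma> s" "\<gamma> t"] unfolding fd[symmetric] by simp
    also have "\<dots> \<le> emeasure lborel (\<Union>i. J i)"
    proof (rule emeasure_mono)
      show "{f (\<gamma> s)..f (\<gamma> t)} \<subseteq> (\<Union>i. J i)"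
      proof
        fix y assume "y \<in> {f (\<gamma> s)..f (\<gamma> t)}"
        then obtain x where x: "x \<in> \<gamma> ` {s..t}" "y = f x" using sub by blast
        then obtain i where i: "x \<in> C i" using C(1) by blast
        have "y \<in> J i" using i x bd[of i] by (auto simp: J_def intro: cInf_lower cSup_upper)
        then show "y \<in> (\<Union>i. J i)" by blast
      qed
    qed (auto simp: J_def)
    also have "\<dots> \<le> (\<Sum>i. emeasure lborel (J i))"
      by (rule emeasure_subadditive_countably) (auto simp: J_def)
    also have "\<dots> \<le> (\<Sum>i. ennreal (diameter (C i)))" by (intro suminf_le len) auto
    finally show "ennreal (dist (\<gamma> s) (\<gamma> t)) \<le> \<dots>" .
  qed
  also have "\<dots> \<le> hausdorff1 (\<gamma> ` {s..t})" by (rule hausdorff1_pre_le_hausdorff1) simp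
  finally show ?thesis .
qed simp

section \<open>Arc length of concave graphs\<close>

text \<open>Cut the interval into n equal pieces: the increments of \<open>M\<close> telescope, and
  the total error (b - a)(M b - M a)/n tends to 0. It plays the role of "nonpositive derivative
  implies decreasing" for functions that need not be differentiable.\<close>

lemma telescoping_le:
  fixes D M :: "real \<Rightarrow> real"
  assumes "a \<le> b"
    and step: "\<And>s t. a \<le> s \<Longrightarrow> s \<le> t \<Longrightarrow> t \<le> b \<Longrightarrow> D t - D s \<le> (t - s) * (M t - M s)"
  shows "D b \<le> D a"
proof -
  have *: "D b - D a \<le> (b - a) * (M b - M a) / real n" if "n > 0" for n
  proof -
    define p where "p i = a + real i * ((b - a) / real n)" for i
    have p0: "p 0 = a" "p n = b" using that by (auto simp: p_def)
    have tele: "(\<Sum>i<n. h (p (Suc i)) - h (p i)) = h (p n) - h (p 0)" for h :: "real \<Rightarrow> real"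
      by (rule sum_lessThan_telescope[of "\<lambda>i. h (p i)"])
    have "D (p n) - D (p 0) = (\<Sum>i<n. D (p (Suc i)) - D (p i))"
      by (rule tele[symmetric])
    also have "\<dots> \<le> (\<Sum>i<n. (b - a) / real n * (M (p (Suc i)) - M (p i)))"
    proof (rule sum_mono)
      fix i assume "i \<in> {..<n}"
      then have i: "real (Suc i) \<le> real n" by simp
      have d: "p (Suc i) - p i = (b - a) / real n" by (simp add: p_def algebra_simps add_divide_distrib diff_divide_distrib)
      have "real (Suc i) * ((b - a) / real n) \<le> real n * ((b - a) / real n)"
        using i \<open>a \<le> b\<close> by (intro mult_right_mono) auto
      then have "p (Suc i) \<le> b" using that by (simp add: p_def)
      moreover have "a \<le> p i" using \<open>a \<le> b\<close> by (simp add: p_def)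
      moreover have "p i \<le> p (Suc i)" using d \<open>a \<le> b\<close> by (metis diff_ge_0_iff_ge divide_nonneg_nonneg of_nat_0_le_iff)
      ultimately show "D (p (Suc i)) - D (p i) \<le> (b - a) / real n * (M (p (Suc i)) - M (p i))"
        using step[of "p i" "p (Suc i)"] d by simp
    qed
    also have "\<dots> = (b - a) / real n * (M (p n) - M (p 0))"
      by (simp only: sum_distrib_left[symmetric] tele)
    finally show ?thesis unfolding p0 by simp
  qed
  have "(\<lambda>n. (b - a) * (M b - M a) / real n) \<longlonglongrightarrow> 0"
    by (intro tendsto_divide_0[OF tendsto_const] filterlim_at_top_imp_at_infinity filterlim_real_sequentially)
  then have "D b - D a \<le> 0"
    by (rule LIMSEQ_le_const) (use * in \<open>auto intro!: exI[of _ 1]\<close>)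
  then show ?thesis by simp
qed

text \<open>A fundamental theorem of calculus for integrands with jumps. The mean of
  \<open>f\<close> and the difference quotient of \<open>F\<close> lie between the same two bounds
  on each subinterval, so \<open>F\<close> minus the integral of \<open>f\<close> has increments
  small enough for \<open>telescoping_le\<close>, applied to it and to its negative.\<close>

lemma has_integral_by_slope_bounds:
  fixes f F M :: "real \<Rightarrow> real"
  assumes "a \<le> b" "f integrable_on {a..b}"
    and f: "\<And>s r t. a \<le> s \<Longrightarrow> s \<le> r \<Longrightarrow> r \<le> t \<Longrightarrow> t \<le> b \<Longrightarrow> lo s t \<le> f r \<and> f r \<le> up s t"
    and F: "\<And>s t. a \<le> s \<Longrightarrow> s \<le> t \<Longrightarrow> t \<le> b \<Longrightarrow> (t - s) * lo s t \<le> F t - F s \<and> F t - F s \<le> (t - s) * up s t"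
    and M: "\<And>s t. a \<le> s \<Longrightarrow> s \<le> t \<Longrightarrow> t \<le> b \<Longrightarrow> up s t - lo s t \<le> M t - M s"
  shows "(f has_integral (F b - F a)) {a..b}"
proof -
  define I where "I t = integral {a..t} f" for t
  have int: "f integrable_on {s..t}" if "a \<le> s" "t \<le> b" for s t
    using assms(2) that by (rule_tac integrable_subinterval_real) auto
  have I: "I t - I s = integral {s..t} f" if "a \<le> s" "s \<le> t" "t \<le> b" for s t
    using Henstock_Kurzweil_Integration.integral_combine[OF that(1,2) int[of a t]] that by (simp add: I_def)
  have Ib: "(t - s) * lo s t \<le> I t - I s \<and> I t - I s \<le> (t - s) * up s t"
    if "a \<le> s" "s \<le> t" "t \<le> b" for s t
  proof -
    have c: "((\<lambda>r. k) has_integral (t - s) * k) {s..t}" for k :: real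
      using has_integral_const_real[of k s t] that by simp
    have "(f has_integral (I t - I s)) {s..t}"
      unfolding I[OF that] using int[OF that(1,3)] by (rule integrable_integral)
    then show ?thesis
      using has_integral_le[OF c[of "lo s t"], of f "I t - I s"]
        has_integral_le[OF _ c[of "up s t"], of f "I t - I s"] f that by auto
  qed
  have key: "\<bar>(F t - I t) - (F s - I s)\<bar> \<le> (t - s) * (M t - M s)" if "a \<le> s" "s \<le> t" "t \<le> b" for s t
  proof -
    have "\<bar>(F t - I t) - (F s - I s)\<bar> \<le> (t - s) * up s t - (t - s) * lo s t"
      using F[OF that] Ib[OF that] by linarith
    also have "\<dots> = (t - s) * (up s t - lo s t)" by (simp add: algebra_simps)
    also have "\<dots> \<le> (t - s) * (M t - M s)" using M[OF that] that by (intro mult_left_mono) auto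
    finally show ?thesis .
  qed
  have "F b - I b \<le> F a - I a"
    by (rule telescoping_le[OF assms(1), of "\<lambda>x. F x - I x" M]) (use key in \<open>fastforce\<close>)
  moreover have "- (F b - I b) \<le> - (F a - I a)"
    by (rule telescoping_le[OF assms(1), of "\<lambda>x. - (F x - I x)" M]) (use key in \<open>fastforce\<close>)
  ultimately have "F b - F a = integral {a..b} f" by (simp add: I_def)
  then show ?thesis using assms(2) by (metis integrable_integral)
qed

text \<open>In the coordinates \<open>s = x\<^sub>1 - x\<^sub>2\<close> and \<open>x\<^sub>1 + x\<^sub>2\<close> the upper right part of the boundary of the body
  is the graph of a concave function \<open>g\<close> with supergradient \<open>G\<close>; \<open>gam\<close> is the arc in the original
  coordinates, \<open>spd\<close> its speed, and \<open>nu\<close> its arc length as a measure on the parameter interval.\<close>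

locale concave_arc =
  fixes g G :: "real \<Rightarrow> real"
  assumes antimono_G: "s \<le> t \<Longrightarrow> G t \<le> G s"
    and G_bounds: "-1 \<le> G s" "G s \<le> 1"
    and supergradient: "s \<in> {-1..1} \<Longrightarrow> t \<in> {-1..1} \<Longrightarrow> g t \<le> g s + G s * (t - s)"
begin

definition gam :: "real \<Rightarrow> real \<times> real" where
  "gam s = ((g s + s) / 2, (g s - s) / 2)"

definition spd :: "real \<Rightarrow> real" where
  "spd s = sqrt ((1 + (G s)\<^sup>2) / 2)"

definition nu :: "real measure" where
  "nu = density lborel (\<lambda>s. ennreal (spd s) * indicator {-1..1} s)"

lemma borel_G [measurable]: "G \<in> borel_measurable borel"
proof -
  have "(\<lambda>s. - G s) \<in> borel_measurable borel"
    by (rule borel_measurable_mono) (auto simp: mono_def antimono_G)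
  then have "(\<lambda>s. - (- G s)) \<in> borel_measurable borel" by measurable
  then show ?thesis by simp
qed

lemma borel_spd [measurable]: "spd \<in> borel_measurable borel"
  unfolding spd_def[abs_def] by measurable

lemma sets_nu [simp, measurable_cong]: "sets nu = sets borel" and space_nu [simp]: "space nu = UNIV"
  by (simp_all add: nu_def)

section \<open>Chord length compared with arc length\<close>

lemma G_sq: "(G s)\<^sup>2 \<le> 1"
  using G_bounds[of s] by (simp add: abs_le_iff flip: abs_le_square_iff[of _ 1, simplified])

lemma spd_pos: "0 < spd s" and spd_le_1: "spd s \<le> 1"
  using G_sq[of s] by (auto simp: spd_def add_pos_nonneg)

lemma norm_diag_le: "norm (x / 2, x / 2) \<le> \<bar>x\<bar>" for x :: real
  using norm_Pair_le[of "x/2" "x/2"] by simp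

lemma spd_eq_norm: "spd s = norm ((1 + G s) / 2, (G s - 1) / 2)"
  by (simp add: spd_def norm_Pair power2_eq_square field_simps)

lemma spd_lipschitz: "\<bar>spd r - spd s\<bar> \<le> \<bar>G r - G s\<bar>"
proof -
  have "\<bar>spd r - spd s\<bar> \<le> norm (((1 + G r) / 2, (G r - 1) / 2) - ((1 + G s) / 2, (G s - 1) / 2))"
    unfolding spd_eq_norm by (rule norm_triangle_ineq3)
  also have "\<dots> = norm ((G r - G s) / 2, (G r - G s) / 2)" by (simp add: diff_divide_distrib add_divide_distrib)
  also have "\<dots> \<le> \<bar>G r - G s\<bar>" by (rule norm_diag_le)
  finally show ?thesis .
qed

lemma g_diff:
  assumes "-1 \<le> s" "s \<le> t" "t \<le> 1"
  shows "(t - s) * G t \<le> g t - g s" "g t - g s \<le> (t - s) * G s"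
  using supergradient[of s t] supergradient[of t s] assms by (auto simp: algebra_simps)

text \<open>The chord vector differs from t - s times the tangent vector at \<open>s\<close> by
  (e/2, e/2), where \<open>e\<close> is the deviation of \<open>g\<close> from its supporting line.
  The supergradients at both ends bound \<open>e\<close>, and the error has the shape that
  \<open>telescoping_le\<close> absorbs.\<close>

lemma dist_gam_approx:
  assumes "-1 \<le> s" "s \<le> t" "t \<le> 1"
  shows "\<bar>dist (gam s) (gam t) - (t - s) * spd s\<bar> \<le> (t - s) * (G s - G t)"
proof -
  define e where "e = g t - g s - (t - s) * G s"
  have e: "\<bar>e\<bar> \<le> (t - s) * (G s - G t)"
    using g_diff[OF assms] by (auto simp: e_def algebra_simps)
  have d: "gam t - gam s - (t - s) *\<^sub>R ((1 + G s) / 2, (G s - 1) / 2) = (e / 2, e / 2)"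
    by (rule prod_eqI) (simp_all add: gam_def e_def algebra_simps add_divide_distrib diff_divide_distrib)
  have "(t - s) * spd s = norm ((t - s) *\<^sub>R ((1 + G s) / 2, (G s - 1) / 2))"
    using assms unfolding norm_scaleR spd_eq_norm by simp
  then have "\<bar>dist (gam s) (gam t) - (t - s) * spd s\<bar> \<le> norm (e / 2, e / 2)"
    using norm_triangle_ineq3[of "gam t - gam s" "(t - s) *\<^sub>R ((1 + G s) / 2, (G s - 1) / 2)"]
    unfolding d by (simp add: dist_norm norm_minus_commute)
  also have "\<dots> \<le> \<bar>e\<bar>" by (rule norm_diag_le)
  finally show ?thesis using e by simp
qed

lemma emeasure_nu: "A \<in> sets borel \<Longrightarrow> emeasure nu A = (\<integral>\<^sup>+s. ennreal (spd s) * indicator ({-1..1} \<inter> A) s \<partial>lborel)"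
  unfolding nu_def by (subst emeasure_density) (auto intro!: nn_integral_cong simp: indicator_def)

lemma emeasure_nu_bounds:
  assumes "-1 \<le> s" "s \<le> t" "t \<le> 1" "\<And>r. s \<le> r \<Longrightarrow> r \<le> t \<Longrightarrow> lo \<le> spd r \<and> spd r \<le> up"
  shows "ennreal ((t - s) * lo) \<le> emeasure nu {s..t}" "emeasure nu {s..t} \<le> ennreal ((t - s) * up)"
proof -
  have I: "{-1..1} \<inter> {s..t} = {s..t}" using assms by auto
  have c: "(\<integral>\<^sup>+r. ennreal k * indicator {s..t} r \<partial>lborel) = ennreal ((t - s) * k)" for k
    using assms(2) by (simp add: nn_integral_cmult_indicator ennreal_mult'' mult.commute)
  have "ennreal lo * indicator {s..t} r \<le> ennreal (spd r) * indicator {s..t} r"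
    "ennreal (spd r) * indicator {s..t} r \<le> ennreal up * indicator {s..t} r" for r
    using assms(4)[of r] by (auto simp: indicator_def intro!: ennreal_leI)
  then show "ennreal ((t - s) * lo) \<le> emeasure nu {s..t}" "emeasure nu {s..t} \<le> ennreal ((t - s) * up)"
    unfolding c[symmetric] by (auto simp: emeasure_nu I simp del: Int_atLeastAtMost intro!: nn_integral_mono)
qed

lemma nu_Icc: "emeasure nu {-1..1} \<le> 2"
  using emeasure_nu_bounds(2)[of "-1" 1 0 1] spd_le_1 spd_pos by (auto simp: less_imp_le)

sublocale nu: finite_measure nu
proof
  have "emeasure nu UNIV = emeasure nu {-1..1}" by (simp add: emeasure_nu)
  then show "emeasure nu (space nu) \<noteq> \<infinity>" using nu_Icc by (auto simp: top_unique)
qed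

text \<open>The speed is 1-Lipschitz as a function of \<open>G\<close>, so the arc length obeys the
  same estimate as the chord.\<close>

lemma nu_approx:
  assumes "-1 \<le> s" "s \<le> t" "t \<le> 1"
  shows "\<bar>measure nu {s..t} - (t - s) * spd s\<bar> \<le> (t - s) * (G s - G t)"
proof -
  define k where "k = G s - G t"
  have "spd s - k \<le> spd r \<and> spd r \<le> spd s + k" if "s \<le> r" "r \<le> t" for r
    using spd_lipschitz[of r s] antimono_G[OF that(1)] antimono_G[OF that(2)] by (auto simp: k_def)
  from emeasure_nu_bounds[OF assms this]
  have "ennreal ((t - s) * (spd s - k)) \<le> ennreal (measure nu {s..t})"
    "ennreal (measure nu {s..t}) \<le> ennreal ((t - s) * (spd s + k))"
    by (simp_all add: nu.emeasure_eq_measure)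
  moreover have "0 \<le> (t - s) * (spd s + k)"
    using assms spd_pos[of s] antimono_G[of s t] by (auto simp: k_def)
  ultimately have "(t - s) * (spd s - k) \<le> measure nu {s..t}" "measure nu {s..t} \<le> (t - s) * (spd s + k)"
    by (simp_all add: ennreal_le_iff measure_nonneg)
  then show ?thesis by (auto simp: k_def algebra_simps)
qed

lemma nu_null: "emeasure lborel A = 0 \<Longrightarrow> A \<in> sets borel \<Longrightarrow> emeasure nu A = 0"
proof -
  assume A: "emeasure lborel A = 0" "A \<in> sets borel"
  then have "A \<in> null_sets lborel" by auto
  then have "AE x in lborel. x \<notin> A" by (rule AE_not_in)
  then have "AE x in lborel. ennreal (spd x) * indicator ({-1..1} \<inter> A) x = 0"
    by eventually_elim (auto simp: indicator_def)
  then show ?thesis using A(2) by (subst emeasure_nu) (auto simp: nn_integral_0_iff_AE)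
qed

lemma nu_countable: "countable A \<Longrightarrow> emeasure nu A = 0"
  by (rule nu_null) (auto simp: emeasure_lborel_countable intro: sets.countable)

lemma nu_combine:
  assumes "a \<le> s" "s \<le> t"
  shows "measure nu {a..t} = measure nu {a..s} + measure nu {s..t}"
proof -
  have "measure nu {s} = 0" by (simp add: measure_def nu_countable)
  moreover have "{a..t} = {a..s} \<union> {s..t}" "{a..s} \<inter> {s..t} = {s}" using assms by auto
  ultimately show ?thesis
    using nu.finite_measure_Union'[of "{a..s}" "{s..t}"]
      nu.finite_measure_Diff'[of "{s..t}" "{a..s}"] by (simp add: Int_commute)
qed

text \<open>By the triangle inequality, chord minus arc length grows over a short step by at most
  the sum of the two approximation errors; this is where the factor 2 in \<open>- 2 * G t\<close>
  comes from.\<close>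

lemma dist_gam_le_nu:
  assumes "-1 \<le> s" "s \<le> t" "t \<le> 1"
  shows "dist (gam s) (gam t) \<le> measure nu {s..t}"
proof -
  have "dist (gam s) (gam t) - measure nu {s..t} \<le> dist (gam s) (gam s) - measure nu {s..s}"
  proof (rule telescoping_le[OF assms(2), of "\<lambda>t. dist (gam s) (gam t) - measure nu {s..t}" "\<lambda>t. - 2 * G t"])
    fix p q assume pq: "s \<le> p" "p \<le> q" "q \<le> t"
    then have *: "-1 \<le> p" "q \<le> 1" using assms by auto
    show "(dist (gam s) (gam q) - measure nu {s..q}) - (dist (gam s) (gam p) - measure nu {s..p})
       \<le> (q - p) * (- 2 * G q - - 2 * G p)"
      using nu_combine[OF pq(1,2)] nu_approx[OF *(1) pq(2) *(2)] dist_gam_approx[OF *(1) pq(2) *(2)]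
        dist_triangle[of "gam s" "gam q" "gam p"] by (simp add: algebra_simps)
  qed
  then show ?thesis by (simp add: measure_def nu_countable)
qed

lemma g_lipschitz:
  assumes "s \<in> {-1..1}" "t \<in> {-1..1}" shows "\<bar>g t - g s\<bar> \<le> \<bar>t - s\<bar>"
proof -
  have *: "\<bar>g t - g s\<bar> \<le> \<bar>t - s\<bar>" if "-1 \<le> s" "s \<le> t" "t \<le> 1" for s t
  proof -
    have "(t - s) * G s \<le> (t - s) * 1" "(t - s) * (-1) \<le> (t - s) * G t"
      by (rule mult_left_mono; use that G_bounds in simp)+
    then show ?thesis using g_diff[OF that] that by auto
  qed
  show ?thesis using *[of s t] *[of t s] assms by (cases "s \<le> t") auto
qed

section \<open>Hausdorff measure of images under the arc\<close>

lemma continuous_gam: "continuous_on {-1..1} gam"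
proof -
  have "continuous_on {-1..1} g"
  proof (rule continuous_onI, rule exI, intro conjI)
    fix x e :: real assume "x \<in> {-1..1}" "0 < e"
    then show "\<forall>x'\<in>{-1..1}. dist x' x < e \<longrightarrow> dist (g x') (g x) \<le> e"
      using g_lipschitz[of x] by (force simp: dist_real_def)
  qed
  then show ?thesis unfolding gam_def by (intro continuous_intros) auto
qed

text \<open>The parameter is the difference of the two coordinates of \<open>gam\<close>. The bound
  makes arcs over separated parameter intervals separated.\<close>

lemma dist_gam_ge: "\<bar>s - t\<bar> / 2 \<le> dist (gam s) (gam t)"
  using dist_fst_le[of "gam s" "gam t"] dist_snd_le[of "gam s" "gam t"]
  by (simp add: gam_def dist_real_def field_simps abs_if split: if_splits)

text \<open>Outer regularity gives an open \<open>U\<close> around \<open>E\<close> of hardly larger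
  \<open>nu\<close>-measure. A covering theorem fills it with short nonoverlapping intervals
  covering \<open>E\<close>; the image of each has diameter at most its \<open>nu\<close>-measure,
  and these add up to at most that of \<open>U\<close>.\<close>

lemma hausdorff1_gam_le:
  assumes E: "E \<in> sets borel" "E \<subseteq> {-1..1}"
  shows "hausdorff1 (gam ` E) \<le> emeasure nu E"
  unfolding hausdorff1_def
proof (rule SUP_least)
  fix \<delta> :: real assume "\<delta> \<in> {0<..}"
  then have \<delta>: "\<delta> > 0" by simp
  show "hausdorff1_pre \<delta> (gam ` E) \<le> emeasure nu E"
  proof (rule ennreal_le_epsilon)
    fix e :: real assume "emeasure nu E < \<top>" "0 < e"
    then have "emeasure nu E < emeasure nu E + ennreal e"
      by (simp add: ennreal_add_left_cancel_less)
    moreover have "emeasure nu E = (INF U \<in> {U. E \<subseteq> U \<and> open U}. emeasure nu U)"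
      by (rule outer_regular) (use E nu.emeasure_finite[of UNIV] in auto)
    ultimately have "(INF U \<in> {U. E \<subseteq> U \<and> open U}. emeasure nu U) < emeasure nu E + ennreal e" by simp
    then obtain U where U: "E \<subseteq> U" "open U" "emeasure nu U < emeasure nu E + ennreal e"
      unfolding INF_less_iff by auto
    \<comment> \<open>Intersecting with \<open>U\<close> keeps the intervals inside
      \<open>U\<close>, and radius \<delta>/2 keeps their length below \<delta>. The value off
      \<open>U\<close> is arbitrary; a gauge must be defined everywhere.\<close>
    define h where "h x = (if x \<in> U then U \<inter> ball x (\<delta>/2) else ball x 1)" for x :: real
    have "gauge h" unfolding gauge_def h_def using U(2) \<delta> by auto
    moreover have "E \<subseteq> cbox (-1) 1" using E by simp
    moreover have "box (-1) (1::real) \<noteq> {}" by simp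
    ultimately obtain \<D> where D: "countable \<D>" "\<Union>\<D> \<subseteq> cbox (-1) (1::real)"
      "\<And>K. K \<in> \<D> \<Longrightarrow> interior K \<noteq> {} \<and> (\<exists>c d. K = cbox c d)"
      "pairwise (\<lambda>A B. interior A \<inter> interior B = {}) \<D>"
      "\<And>K. K \<in> \<D> \<Longrightarrow> \<exists>x \<in> E \<inter> K. K \<subseteq> h x" "E \<subseteq> \<Union>\<D>"
      using covering_lemma[of E "-1" 1 h] by metis
    have K: "bounded (gam ` K) \<and> diameter (gam ` K) \<le> measure nu K \<and> measure nu K \<le> \<delta> \<and> K \<subseteq> U
       \<and> emeasure nu (interior K) = emeasure nu K" if KD: "K \<in> \<D>" for K
    proof -
      obtain c d where cd: "K = {c..d}" using D(3)[OF KD] by auto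
      have c: "c < d" using D(3)[OF KD] by (auto simp: cd)
      have K1: "K \<subseteq> {-1..1}" using D(2) KD by auto
      then have b: "-1 \<le> c" "d \<le> 1" using c by (auto simp: cd)
      obtain x where x: "x \<in> E" "x \<in> K" "K \<subseteq> h x" using D(5)[OF KD] by auto
      have "x \<in> U" using x(1) U(1) by auto
      then have KU: "K \<subseteq> U" "K \<subseteq> ball x (\<delta>/2)" using x(3) unfolding h_def by auto
      have "c \<in> ball x (\<delta>/2)" "d \<in> ball x (\<delta>/2)" using subsetD[OF KU(2)] c by (auto simp: cd)
      then have "\<bar>x - c\<bar> < \<delta>/2" "\<bar>x - d\<bar> < \<delta>/2" by (auto simp: dist_real_def)
      then have "d - c \<le> \<delta>" by linarith
      moreover have "emeasure nu {c..d} \<le> ennreal ((d - c) * 1)"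
        using emeasure_nu_bounds(2)[OF b(1) less_imp_le[OF c] b(2), of 0 1] spd_le_1 spd_pos
        by (auto simp: less_imp_le)
      ultimately have m: "measure nu K \<le> \<delta>"
        using c by (auto simp: cd nu.emeasure_eq_measure)
      have diam: "diameter (gam ` K) \<le> measure nu K"
      proof (rule diameter_le)
        have *: "dist (gam p) (gam q) \<le> measure nu K" if "p \<in> K" "q \<in> K" "p \<le> q" for p q
        proof -
          have "dist (gam p) (gam q) \<le> measure nu {p..q}"
            using that b by (intro dist_gam_le_nu) (auto simp: cd)
          also have "\<dots> \<le> measure nu K"
            using that by (intro nu.finite_measure_mono) (auto simp: cd)
          finally show ?thesis .
        qed
        fix y z assume "y \<in> gam ` K" "z \<in> gam ` K"
        then obtain p q where "p \<in> K" "q \<in> K" "y = gam p" "z = gam q" by auto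
        then show "norm (y - z) \<le> measure nu K"
          using *[of p q] *[of q p] by (cases "p \<le> q") (auto simp: dist_norm norm_minus_commute)
      qed simp
      have "compact (gam ` K)"
        by (intro compact_continuous_image continuous_on_subset[OF continuous_gam K1]) (simp add: cd)
      then have bd: "bounded (gam ` K)" by (rule compact_imp_bounded)
      \<comment> \<open>Only the interiors are disjoint; end points are \<open>nu\<close>-null, so
        replacing intervals by their interiors costs nothing.\<close>
      have "emeasure nu K = emeasure nu ({c<..<d} \<union> {c, d})"
        using c by (intro arg_cong[of _ _ "emeasure nu"]) (auto simp: cd)
      also have "\<dots> \<le> emeasure nu {c<..<d} + emeasure nu {c, d}" by (rule emeasure_subadditive) auto
      also have "\<dots> = emeasure nu {c<..<d}" by (simp add: nu_countable)
      finally have "emeasure nu K \<le> emeasure nu {c<..<d}" .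
      moreover have "emeasure nu {c<..<d} \<le> emeasure nu K" by (rule emeasure_mono) (auto simp: cd)
      ultimately have "emeasure nu (interior K) = emeasure nu K" by (simp add: cd)
      with bd diam m KU show ?thesis by auto
    qed
    have "hausdorff1_pre \<delta> (gam ` E) \<le> (\<integral>\<^sup>+ K. ennreal (diameter (gam ` K)) \<partial>count_space \<D>)"
    proof (rule hausdorff1_pre_le_countable[OF D(1)])
      show "gam ` E \<subseteq> (\<Union>K\<in>\<D>. gam ` K)" using D(6) by auto
    qed (use K \<delta> order_trans in \<open>blast+\<close>)
    also have "\<dots> \<le> (\<integral>\<^sup>+ K. emeasure nu (interior K) \<partial>count_space \<D>)"
      using K by (intro nn_integral_mono) (auto simp: nu.emeasure_eq_measure intro!: ennreal_leI)
    also have "\<dots> = emeasure nu (\<Union>K\<in>\<D>. interior K)"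
      by (rule emeasure_UN_countable[symmetric]) (use D(1,4) in \<open>auto simp: disjoint_family_on_def pairwise_def\<close>)
    also have "\<dots> \<le> emeasure nu U"
    proof (rule emeasure_mono)
      show "(\<Union>K\<in>\<D>. interior K) \<subseteq> U" using K interior_subset by blast
    qed (use U(2) in auto)
    also have "\<dots> \<le> emeasure nu E + ennreal e" using U(3) by simp
    finally show "hausdorff1_pre \<delta> (gam ` E) \<le> \<dots>" .
  qed
qed

text \<open>Adjacent arcs touch and are therefore not separated. Deleting the parameters between s -
  e and s separates them at the price of a piece of length at most e, since the speed is at most
  1.\<close>

lemma hausdorff1_gam_superadd:
  assumes "-1 \<le> s" "s \<le> t" "t \<le> 1"
  shows "hausdorff1 (gam ` {-1..s}) + hausdorff1 (gam ` {s..t}) \<le> hausdorff1 (gam ` {-1..t})"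
proof (rule ennreal_le_epsilon)
  fix e :: real assume e: "0 < e"
  \<comment> \<open>Clipped so as to stay in the parameter interval; when s - e is below -1 the
    other piece is empty.\<close>
  define a where "a = max (-1) (s - e)"
  have a: "-1 \<le> a" "a \<le> s" "s - a \<le> e" using assms e by (auto simp: a_def)
  have "hausdorff1 (gam ` {-1..s}) \<le> hausdorff1 (gam ` {-1..s-e} \<union> gam ` {a..s})"
    by (intro hausdorff1_mono) (force simp: a_def)
  also have "\<dots> \<le> hausdorff1 (gam ` {-1..s-e}) + hausdorff1 (gam ` {a..s})" by (rule hausdorff1_subadd)
  also have "hausdorff1 (gam ` {a..s}) \<le> emeasure nu {a..s}"
    using a assms by (intro hausdorff1_gam_le) auto
  also have "\<dots> \<le> ennreal ((s - a) * 1)"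
    using a assms spd_pos spd_le_1 by (intro emeasure_nu_bounds(2)[of a s 0]) (auto simp: less_imp_le)
  also have "\<dots> \<le> ennreal e" using a by (intro ennreal_leI) simp
  finally have 1: "hausdorff1 (gam ` {-1..s}) \<le> hausdorff1 (gam ` {-1..s-e}) + ennreal e"
    by (simp add: add_left_mono)
  have "hausdorff1 (gam ` {-1..s-e}) + hausdorff1 (gam ` {s..t}) \<le> hausdorff1 (gam ` {-1..s-e} \<union> gam ` {s..t})"
  proof (rule hausdorff1_add_separated[of "e/2"])
    fix x y assume "x \<in> gam ` {-1..s-e}" "y \<in> gam ` {s..t}"
    then obtain p q where "p \<le> s - e" "s \<le> q" "x = gam p" "y = gam q" by auto
    then show "e / 2 \<le> dist x y" using dist_gam_ge[of p q] by simp
  qed (use e in simp)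
  also have "\<dots> \<le> hausdorff1 (gam ` {-1..t})" using e assms by (intro hausdorff1_mono) auto
  finally have 2: "hausdorff1 (gam ` {-1..s-e}) + hausdorff1 (gam ` {s..t}) \<le> hausdorff1 (gam ` {-1..t})" .
  show "hausdorff1 (gam ` {-1..s}) + hausdorff1 (gam ` {s..t}) \<le> hausdorff1 (gam ` {-1..t}) + ennreal e"
    by (rule order_trans[OF add_right_mono[OF 1]], rule order_trans[OF _ add_right_mono[OF 2]])
      (simp add: ac_simps)
qed

text \<open>Let \<open>h t\<close> be the Hausdorff length of the arc up to \<open>t\<close>. By
  superadditivity it grows at least by the chord, which agrees with the \<open>nu\<close>-length up
  to the error of \<open>telescoping_le\<close>; so \<open>nu\<close> cannot overtake
  \<open>h\<close>.\<close>

lemma hausdorff1_gam_total: "emeasure nu {-1..1} \<le> hausdorff1 (gam ` {-1..1})"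
proof -
  define h where "h t = enn2real (hausdorff1 (gam ` {-1..t}))" for t
  have h: "hausdorff1 (gam ` {-1..t}) = ennreal (h t)" if "t \<le> 1" for t
  proof -
    have "hausdorff1 (gam ` {-1..t}) \<le> emeasure nu {-1..t}" using that by (intro hausdorff1_gam_le) auto
    also have "\<dots> < \<top>" by (simp add: nu.emeasure_eq_measure)
    finally show ?thesis by (simp add: h_def)
  qed
  have h0: "0 \<le> h t" for t by (simp add: h_def)
  have "measure nu {-1..1} - h 1 \<le> measure nu {-1.. -1} - h (-1)"
  proof (rule telescoping_le[of "-1" 1 "\<lambda>t. measure nu {-1..t} - h t" "\<lambda>t. - 2 * G t"])
    fix s t :: real assume st: "-1 \<le> s" "s \<le> t" "t \<le> 1"
    have "ennreal (h s + dist (gam s) (gam t)) \<le> hausdorff1 (gam ` {-1..s}) + hausdorff1 (gam ` {s..t})"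
      using h[of s] h0[of s] st hausdorff1_ge_dist[OF continuous_on_subset[OF continuous_gam] st(2)]
      by (simp add: add_left_mono)
    also have "\<dots> \<le> ennreal (h t)" using hausdorff1_gam_superadd[OF st] h[of t] st by simp
    finally have "h s + dist (gam s) (gam t) \<le> h t" using h0[of t] by (simp add: ennreal_le_iff)
    then show "measure nu {-1..t} - h t - (measure nu {-1..s} - h s) \<le> (t - s) * (- 2 * G t - - 2 * G s)"
      using nu_combine[OF st(1,2)] nu_approx[OF st] dist_gam_approx[OF st] by (simp add: algebra_simps)
  qed simp
  then have "measure nu {-1..1} \<le> h 1" using h0[of "-1"] by (simp add: measure_def nu_countable)
  then show ?thesis using h[of 1] h0 by (simp add: nu.emeasure_eq_measure ennreal_leI)
qed

text \<open>The upper bound for \<open>E\<close> and for its complement, together with the exact total length,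
  forces equality; no measurability theory for the Hausdorff measure is needed.\<close>

lemma hausdorff1_gam:
  assumes E: "E \<in> sets borel" "E \<subseteq> {-1..1}"
  shows "hausdorff1 (gam ` E) = emeasure nu E"
proof (rule antisym[OF hausdorff1_gam_le[OF E]])
  have "emeasure nu E + emeasure nu ({-1..1} - E) = emeasure nu {-1..1}"
    using E by (subst plus_emeasure) (auto intro!: arg_cong[of _ _ "emeasure nu"])
  also have "\<dots> \<le> hausdorff1 (gam ` {-1..1})" by (rule hausdorff1_gam_total)
  also have "\<dots> \<le> hausdorff1 (gam ` E \<union> gam ` ({-1..1} - E))" by (intro hausdorff1_mono) auto
  also have "\<dots> \<le> hausdorff1 (gam ` E) + hausdorff1 (gam ` ({-1..1} - E))" by (rule hausdorff1_subadd)
  also have "\<dots> \<le> hausdorff1 (gam ` E) + emeasure nu ({-1..1} - E)"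
    using E by (intro add_left_mono hausdorff1_gam_le) auto
  finally show "emeasure nu E \<le> hausdorff1 (gam ` E)"
    using nu.emeasure_finite[of "{-1..1} - E"] by (simp add: add.commute ennreal_add_left_cancel_le)
qed

end

section \<open>The boundary arc of a planar convex body\<close>

text \<open>Turning the frame back, the supporting line of slope \<open>G s\<close> becomes one with
  outer normal (1 - G s, 1 + G s), which lies in the quadrant because |G s| is at most 1.\<close>

locale body_arc = concave_arc +
  fixes L :: "(real \<times> real) set"
  assumes compact_L: "compact L"
    and L_unit: "L \<subseteq> {0..1} \<times> {0..1}"
    and gam_in: "s \<in> {-1..1} \<Longrightarrow> gam s \<in> L"
    and gam_dominates: "x \<in> L \<Longrightarrow> fst x \<le> fst (gam (fst x - snd x)) \<and> snd x \<le> snd (gam (fst x - snd x))"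
    and gam_normal: "s \<in> {-1..1} \<Longrightarrow> x \<in> L \<Longrightarrow> inner x (1 - G s, 1 + G s) \<le> inner (gam s) (1 - G s, 1 + G s)"

text \<open>The open diagonal ray beyond \<open>p\<close> misses \<open>L\<close>, and a separating
  line provides a normal with nonnegative coordinate sum. If one coordinate is negative, comparison
  with (1,0) or (0,1) forces \<open>p\<close> onto a side of the square, and the normal of that side
  serves instead.\<close>

lemma ex_normal_in_orthant:
  assumes L: "convex L" "L \<subseteq> {0..1} \<times> {0..1}" "(1,0) \<in> L" "(0,1) \<in> L"
    and p: "p \<in> L" and max: "\<And>q. q \<in> L \<Longrightarrow> fst q - snd q = fst p - snd p \<Longrightarrow> fst q + snd q \<le> fst p + snd p"
  shows "\<exists>a1 a2 :: real. 0 \<le> a1 \<and> 0 \<le> a2 \<and> 0 < a1 + a2 \<and> (\<forall>x\<in>L. inner x (a1, a2) \<le> inner p (a1, a2))"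
proof -
  define T where "T = {x :: real \<times> real. inner (1,-1) x = fst p - snd p} \<inter> {x. inner (1,1) x > fst p + snd p}"
  have T: "p + (e, e) \<in> T" if "e > 0" for e using that by (simp add: T_def inner_prod_def)
  have "convex T" unfolding T_def by (intro convex_Int convex_hyperplane convex_halfspace_gt)
  moreover have "T \<noteq> {}" using T[of 1] by auto
  moreover have "L \<inter> T = {}" using max by (fastforce simp: T_def inner_prod_def)
  ultimately obtain a b where a: "a \<noteq> 0" "\<forall>x\<in>L. inner a x \<le> b" "\<forall>x\<in>T. inner a x \<ge> b"
    using separating_hyperplane_sets[of L T] L(1) p by blast
  obtain a1 a2 where a12: "a = (a1, a2)" by (cases a)
  obtain p1 p2 where p12: "p = (p1, p2)" by (cases p)
  have pin: "0 \<le> p1" "p1 \<le> 1" "0 \<le> p2" "p2 \<le> 1" using p L(2) by (auto simp: p12)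
  have aT: "b \<le> a1 * p1 + a2 * p2 + e * (a1 + a2)" if "e > 0" for e
    using a(3) T[OF that] by (force simp: a12 p12 algebra_simps)
  have le: "a1 * p1 + a2 * p2 \<le> b" using a(2) p by (auto simp: a12 p12)
  have sum: "0 \<le> a1 + a2" using aT[of 1] le by simp
  have b: "b \<le> a1 * p1 + a2 * p2"
  proof (rule field_le_epsilon)
    fix e :: real assume "0 < e"
    \<comment> \<open>The summand 1 keeps the denominator positive, as the coordinate sum might
      still be 0 here.\<close>
    have "e / (1 + (a1 + a2)) * (a1 + a2) \<le> e"
      using \<open>0 < e\<close> sum by (simp add: field_simps)
    then show "b \<le> a1 * p1 + a2 * p2 + e"
      using aT[of "e / (1 + (a1 + a2))"] \<open>0 < e\<close> sum by simp
  qed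
  have n: "x1 * a1 + x2 * a2 \<le> p1 * a1 + p2 * a2" if "(x1, x2) \<in> L" for x1 x2
    using a(2) that b by (force simp: a12 algebra_simps)
  have n1: "a1 \<le> p1 * a1 + p2 * a2" "a2 \<le> p1 * a1 + p2 * a2" using n[OF L(3)] n[OF L(4)] by auto
  have nz: "a1 \<noteq> 0 \<or> a2 \<noteq> 0" using a(1) by (simp add: a12 zero_prod_def)
  consider "0 \<le> a1" "0 \<le> a2" | "a2 < 0" "0 < a1" | "a1 < 0" "0 < a2" using sum by linarith
  then show ?thesis
  proof cases
    case 1
    then show ?thesis using nz n by (intro exI[of _ a1] exI[of _ a2]) (auto simp: p12)
  next
    case 2
    have "p2 * a2 \<le> 0" using 2 pin by (simp add: mult_nonneg_nonpos)
    then have "1 * a1 \<le> p1 * a1" using n1(1) by simp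
    then have "p1 = 1" using 2 pin by (simp add: mult_le_cancel_right)
    then show ?thesis using L(2) by (intro exI[of _ 1] exI[of _ 0]) (auto simp: p12)
  next
    case 3
    have "p1 * a1 \<le> 0" using 3 pin by (simp add: mult_nonneg_nonpos)
    then have "1 * a2 \<le> p2 * a2" using n1(2) by simp
    then have "p2 = 1" using 3 pin by (simp add: mult_le_cancel_right)
    then show ?thesis using L(2) by (intro exI[of _ 0] exI[of _ 1]) (auto simp: p12)
  qed
qed

text \<open>\<open>g s\<close> is the maximum of the coordinate sum over the part of
  \<open>L\<close> on the diagonal line with coordinate difference \<open>s\<close>;
  \<open>G\<close> encodes a normal in the quadrant at the maximiser.\<close>

lemma ex_body_arc:
  assumes L: "compact L" "convex L" "L \<subseteq> {0..1} \<times> {0..1}" "(1,0) \<in> L" "(0,1) \<in> L"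
  shows "\<exists>g G. body_arc g G L"
proof -
  have "\<exists>p\<in>L. fst p - snd p = s \<and> (\<forall>q\<in>L. fst q - snd q = s \<longrightarrow> fst q + snd q \<le> fst p + snd p)"
    if s: "s \<in> {-1..1}" for s
  proof -
    define Q where "Q = L \<inter> {q. fst q - snd q = s}"
    have "closed {q :: real \<times> real. fst q - snd q = s}"
      by (intro closed_Collect_eq continuous_intros)
    then have "compact Q" unfolding Q_def using L(1) by (rule compact_Int_closed[rotated])
    \<comment> \<open>The segment from (1,0) to (0,1) lies in \<open>L\<close> and meets every such
      diagonal line.\<close>
    moreover have "((1+s)/2) *\<^sub>R (1,0) + ((1-s)/2) *\<^sub>R (0,1::real) \<in> L"
      using L(2,4,5) s by (intro convexD) (auto simp: field_simps)
    then have "((1+s)/2, (1-s)/2) \<in> Q" by (auto simp: Q_def field_simps)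
    then have "Q \<noteq> {}" by auto
    moreover have "continuous_on Q (\<lambda>q. fst q + snd q)" by (intro continuous_intros)
    ultimately obtain p where "p \<in> Q" "\<forall>q\<in>Q. fst q + snd q \<le> fst p + snd p"
      using continuous_attains_sup[of Q "\<lambda>q. fst q + snd q"] by blast
    then show ?thesis by (auto simp: Q_def)
  qed
  then obtain p where p: "\<And>s. s \<in> {-1..1} \<Longrightarrow> p s \<in> L" "\<And>s. s \<in> {-1..1} \<Longrightarrow> fst (p s) - snd (p s) = s"
    "\<And>s q. s \<in> {-1..1} \<Longrightarrow> q \<in> L \<Longrightarrow> fst q - snd q = s \<Longrightarrow> fst q + snd q \<le> fst (p s) + snd (p s)"
    by metis
  define g where "g s = fst (p s) + snd (p s)" for s
  have pg: "p s = ((g s + s) / 2, (g s - s) / 2)" if "s \<in> {-1..1}" for s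
    using p(2)[OF that] by (intro prod_eqI) (auto simp: g_def field_simps)
  have "\<exists>c. -1 \<le> c \<and> c \<le> 1 \<and> (\<forall>x\<in>L. inner x (1 - c, 1 + c) \<le> inner (p s) (1 - c, 1 + c))"
    if s: "s \<in> {-1..1}" for s
  proof -
    obtain a1 a2 :: real where a: "0 \<le> a1" "0 \<le> a2" "0 < a1 + a2"
      "\<forall>x\<in>L. inner x (a1, a2) \<le> inner (p s) (a1, a2)"
      using ex_normal_in_orthant[OF L(2-5) p(1)[OF s]] p(3)[OF s] p(2)[OF s] by metis
    \<comment> \<open>Scaling the normal to coordinate sum 2 puts it into the form (1 - c, 1 +
      c).\<close>
    define c where "c = (a2 - a1) / (a1 + a2)"
    have c: "(1 - c, 1 + c) = (2 / (a1 + a2)) *\<^sub>R (a1, a2)"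
      using a(3) by (simp add: c_def field_simps)
    have "-1 \<le> c" "c \<le> 1" using a(1-3) by (auto simp: c_def field_simps)
    moreover have "\<forall>x\<in>L. inner x (1 - c, 1 + c) \<le> inner (p s) (1 - c, 1 + c)"
      unfolding c inner_scaleR_right using a(3,4) by (intro ballI mult_left_mono) auto
    ultimately show ?thesis by blast
  qed
  then obtain c where c: "\<And>s. s \<in> {-1..1} \<Longrightarrow> -1 \<le> c s" "\<And>s. s \<in> {-1..1} \<Longrightarrow> c s \<le> 1"
    "\<And>s x. s \<in> {-1..1} \<Longrightarrow> x \<in> L \<Longrightarrow> inner x (1 - c s, 1 + c s) \<le> inner (p s) (1 - c s, 1 + c s)"
    by metis
  \<comment> \<open>The values 1 and -1 outside the interval extend \<open>G\<close> to a decreasing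
    function on the whole line, so facts on monotone functions of a real variable apply to
    it.\<close>
  define G where "G s = (if s < -1 then 1 else if s > 1 then -1 else c s)" for s :: real
  have super: "g t \<le> g s + G s * (t - s)" if "s \<in> {-1..1}" "t \<in> {-1..1}" for s t
    using c(3)[OF that(1) p(1)[OF that(2)]] that by (simp add: pg G_def field_simps)
  have arc: "concave_arc g G"
  proof
    fix s t :: real
    show "-1 \<le> G s" "G s \<le> 1" using c by (auto simp: G_def)
    show "G t \<le> G s" if "s \<le> t"
    proof (cases "s \<in> {-1..1} \<and> t \<in> {-1..1} \<and> s \<noteq> t")
      case True
      then have "(t - s) * G t \<le> (t - s) * G s"
        using super[of s t] super[of t s] by (simp add: algebra_simps)
      then show ?thesis using True that by simp
    next
      case False
      then show ?thesis using that c(1)[of t] c(2)[of t] c(1)[of s] c(2)[of s] by (auto simp: G_def)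
    qed
  qed (use super in auto)
  interpret concave_arc g G by (rule arc)
  have gam: "gam s = p s" if "s \<in> {-1..1}" for s using pg[OF that] by (simp add: gam_def)
  have "body_arc g G L"
  proof unfold_locales
    fix x assume x: "x \<in> L"
    then have s: "fst x - snd x \<in> {-1..1}" using L(3) by (cases x) auto
    show "fst x \<le> fst (gam (fst x - snd x)) \<and> snd x \<le> snd (gam (fst x - snd x))"
      unfolding gam[OF s] using p(2)[OF s] p(3)[OF s x] by simp
  qed (use L p c gam in \<open>auto simp: G_def\<close>)
  then show ?thesis by blast
qed

lemma closed_S1p: "closed S1p"
proof -
  have *: "S1p = {x. 0 \<le> fst x} \<inter> {x. 0 \<le> snd x} \<inter> {x. (fst x)\<^sup>2 + (snd x)\<^sup>2 = 1}" by (auto simp: S1p_def)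
  show ?thesis unfolding * by (intro closed_Int closed_Collect_le closed_Collect_eq continuous_intros)
qed

lemma S1p_bounds: "x \<in> S1p \<Longrightarrow> 0 \<le> fst x \<and> fst x \<le> 1 \<and> 0 \<le> snd x \<and> snd x \<le> 1"
  using power2_le_imp_le[of "fst x" 1] power2_le_imp_le[of "snd x" 1]
  by (auto simp: S1p_def) (smt (verit) zero_le_power2)+

context body_arc
begin

text \<open>The vector (1 - G s, 1 + G s) has length \<open>2 * spd s\<close>; the factor
  \<open>spd s\<close> later cancels against the density of \<open>nu\<close>.\<close>

definition N :: "real \<Rightarrow> real \<times> real" where
  "N s = ((1 - G s) / 2 / spd s, (1 + G s) / 2 / spd s)"

lemma N_in: "N s \<in> S1p"
proof -
  have "((1 - G s) / 2 / spd s)\<^sup>2 + ((1 + G s) / 2 / spd s)\<^sup>2 = ((1 + (G s)\<^sup>2) / 2) / (spd s)\<^sup>2"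
    using spd_pos[of s] by (simp add: power2_eq_square field_simps)
  also have "(spd s)\<^sup>2 = (1 + (G s)\<^sup>2) / 2" by (simp add: spd_def)
  also have "(1 + (G s)\<^sup>2) / 2 / ((1 + (G s)\<^sup>2) / 2) = 1"
    by (metis add_pos_nonneg divide_self_if half_gt_zero less_numeral_extra(1) less_irrefl zero_le_power2)
  finally show ?thesis using G_bounds[of s] spd_pos[of s] by (auto simp: S1p_def N_def)
qed

section \<open>Unit normals along the arc and their length distribution\<close>

definition normal_measure :: "(real \<times> real) measure" where
  "normal_measure = distr nu (restrict_space borel S1p) N"

lemma measurable_N [measurable]: "N \<in> nu \<rightarrow>\<^sub>M restrict_space borel S1p"
proof (rule measurable_restrict_space2)
  show "N \<in> space nu \<rightarrow> S1p" using N_in by auto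
  show "N \<in> borel_measurable nu"
    unfolding N_def[abs_def] borel_prod[symmetric] by measurable
qed

lemma sets_normal_measure: "sets normal_measure = sets (restrict_space borel S1p)"
  by (simp add: normal_measure_def)

lemma finite_normal_measure: "finite_measure normal_measure"
  unfolding normal_measure_def by (rule nu.finite_measure_distr) measurable

lemma outer_normal_N:
  assumes "s \<in> {-1..1}" shows "outer_unit_normal L (gam s) (N s)"
proof -
  have "N s = (1 / (2 * spd s)) *\<^sub>R (1 - G s, 1 + G s)" by (simp add: N_def)
  moreover have "0 \<le> 1 / (2 * spd s)" using spd_pos[of s] by simp
  moreover have "norm (N s) = 1" using N_in[of s] by (cases "N s") (simp add: S1p_def norm_Pair)
  ultimately show ?thesis
    unfolding outer_unit_normal_def using gam_normal[OF assms] by (metis inner_scaleR_right mult_left_mono)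
qed

text \<open>From a point of \<open>L\<close> below the arc one can move in direction (1,1) inside
  \<open>L\<close>, which strictly increases every functional with nonzero direction in the
  quadrant. Hence a point with such a normal lies on the arc.\<close>

lemma normal_points_eq:
  assumes "A \<subseteq> S1p"
  shows "{x \<in> frontier L. \<exists>u\<in>A. outer_unit_normal L x u} =
    gam ` {s \<in> {-1..1}. \<exists>u\<in>A. outer_unit_normal L (gam s) u}"
proof (intro equalityI subsetI)
  fix x assume "x \<in> {x \<in> frontier L. \<exists>u\<in>A. outer_unit_normal L x u}"
  then obtain u where x: "x \<in> frontier L" and u: "u \<in> A" "outer_unit_normal L x u" by auto
  have xL: "x \<in> L" using x compact_L by (auto simp: frontier_def compact_imp_closed)
  define s where "s = fst x - snd x"
  have s: "s \<in> {-1..1}" using xL L_unit by (cases x) (auto simp: s_def)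
  have uS: "u \<in> S1p" using u assms by auto
  then have pos: "0 \<le> fst u" "0 \<le> snd u" "0 < fst u + snd u"
    by (auto simp: S1p_def) (smt (verit) power_zero_numeral zero_neq_one)
  \<comment> \<open>The shift along the diagonal from \<open>x\<close> to the arc: maximality of
    \<open>x\<close> in direction \<open>u\<close> makes it nonpositive, domination by the arc
    nonnegative.\<close>
  define r where "r = (g s - (fst x + snd x)) / 2"
  have gx: "gam s = x + (r, r)" by (rule prod_eqI) (auto simp: gam_def r_def s_def field_simps)
  have "inner (gam s) u \<le> inner x u" using u(2) gam_in[OF s] by (auto simp: outer_unit_normal_def)
  then have "r * (fst u + snd u) \<le> 0" by (simp add: gx inner_prod_def algebra_simps)
  then have "r \<le> 0" using pos(3) by (simp add: mult_le_0_iff)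
  moreover have "0 \<le> r" using gam_dominates[OF xL] gx by (simp add: s_def)
  ultimately have "gam s = x" by (simp add: gx prod_eq_iff)
  then show "x \<in> gam ` {s \<in> {-1..1}. \<exists>u\<in>A. outer_unit_normal L (gam s) u}"
    using s u by auto
next
  fix x assume "x \<in> gam ` {s \<in> {-1..1}. \<exists>u\<in>A. outer_unit_normal L (gam s) u}"
  then obtain s u where s: "s \<in> {-1..1}" "x = gam s" "u \<in> A" "outer_unit_normal L x u" by auto
  have "x \<notin> interior L"
  proof
    assume "x \<in> interior L"
    then obtain e where e: "e > 0" "ball x e \<subseteq> L" by (auto simp: mem_interior)
    have nu: "norm u = 1" using s by (simp add: outer_unit_normal_def)
    then have "x + (e/2) *\<^sub>R u \<in> ball x e" using e by (simp add: dist_norm)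
    then have "inner (x + (e/2) *\<^sub>R u) u \<le> inner x u"
      using e s(4) by (auto simp: outer_unit_normal_def)
    then show False using e nu by (simp add: inner_add_left dot_square_norm)
  qed
  then show "x \<in> {x \<in> frontier L. \<exists>u\<in>A. outer_unit_normal L x u}"
    using s gam_in compact_L by (auto simp: frontier_def compact_imp_closed)
qed

text \<open>A normal \<open>u\<close> in the quadrant makes \<open>k\<close> = (u2 - u1)/(u1 + u2) a
  supergradient of \<open>g\<close> at \<open>s\<close>. So \<open>k\<close> lies between the
  one-sided limits of \<open>G\<close>, which coincide at a point of continuity.\<close>

lemma normal_unique:
  assumes s: "-1 < s" "s < 1" "isCont G s" and u: "u \<in> S1p" "outer_unit_normal L (gam s) u"
  shows "u = N s"
proof -
  obtain u1 u2 where u12: "u = (u1, u2)" by (cases u)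
  have pos: "0 \<le> u1" "0 \<le> u2" and sq: "u1\<^sup>2 + u2\<^sup>2 = 1" using u by (auto simp: S1p_def u12)
  then have w: "0 < u1 + u2" by (smt (verit) power_zero_numeral zero_neq_one)
  define k where "k = (u2 - u1) / (u1 + u2)"
  have le: "g t - g s \<le> k * (t - s)" if "t \<in> {-1..1}" for t
  proof -
    have "inner (gam t) u \<le> inner (gam s) u" using u(2) gam_in[OF that] by (auto simp: outer_unit_normal_def)
    then have "(u1 + u2) * (g t - g s) \<le> (u2 - u1) * (t - s)" by (simp add: gam_def u12 field_simps)
    then show ?thesis using w by (simp add: k_def field_simps)
  qed
  have "G s \<le> k"
  proof (rule tendsto_upperbound)
    show "(G \<longlongrightarrow> G s) (at_right s)" using s(3) by (simp add: isCont_def filterlim_at_split)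
    have "G t \<le> k" if "s < t" "t < 1" for t
    proof -
      have "(t - s) * G t \<le> g t - g s" using that s by (intro g_diff(1)) auto
      also have "\<dots> \<le> (t - s) * k" using le[of t] that s by (simp add: mult.commute)
      finally have "(t - s) * G t \<le> (t - s) * k" .
      then show ?thesis using that by (simp add: mult_le_cancel_left)
    qed
    then show "\<forall>\<^sub>F t in at_right s. G t \<le> k"
      using s(2) by (auto simp: eventually_at_right[OF s(2)])
  qed simp
  moreover have "k \<le> G s"
  proof (rule tendsto_lowerbound)
    show "(G \<longlongrightarrow> G s) (at_left s)" using s(3) by (simp add: isCont_def filterlim_at_split)
    have "k \<le> G t" if "-1 < t" "t < s" for t
    proof -
      have "(s - t) * k \<le> (s - t) * G t" using g_diff(2)[of t s] le[of t] that s by (auto simp: algebra_simps)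
      then show ?thesis using that by (simp add: mult_le_cancel_left)
    qed
    then show "\<forall>\<^sub>F t in at_left s. k \<le> G t"
      using s(1) by (auto simp: eventually_at_left[OF s(1)])
  qed simp
  ultimately have k: "G s = k" by simp
  \<comment> \<open>The length of \<open>u\<close> being 1, the slope \<open>k\<close> determines
    the scale: the speed is 1/(u1 + u2).\<close>
  have "(1 + k\<^sup>2) / 2 = (1 / (u1 + u2))\<^sup>2"
  proof -
    have "1 + k\<^sup>2 = ((u1 + u2)\<^sup>2 + (u2 - u1)\<^sup>2) / (u1 + u2)\<^sup>2"
      using w by (simp add: k_def power_divide field_simps)
    also have "(u1 + u2)\<^sup>2 + (u2 - u1)\<^sup>2 = 2" using sq by (simp add: power2_eq_square algebra_simps)
    finally show ?thesis by (simp add: power_divide)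
  qed
  then have "spd s = 1 / (u1 + u2)" using w by (simp add: spd_def k)
  moreover have "(1 - k) / 2 = u1 / (u1 + u2)" "(1 + k) / 2 = u2 / (u1 + u2)" using w by (simp_all add: k_def field_simps)
  ultimately show ?thesis using w by (simp only: u12 N_def k) simp
qed

lemma countable_discont: "countable {s. \<not> isCont G s}"
proof -
  have "countable {s. \<not> isCont (\<lambda>s. - G s) s}"
    by (rule mono_ctble_discont) (auto simp: mono_def antimono_G)
  moreover have "isCont (\<lambda>s. - G s) s \<longleftrightarrow> isCont G s" for s
    using isCont_minus[of s G] isCont_minus[of s "\<lambda>s. - G s"] by auto
  ultimately show ?thesis by simp
qed

text \<open>\<open>EA\<close> collects the parameters with some normal in \<open>A\<close>,
  \<open>NA\<close> those whose chosen normal is in \<open>A\<close>. They differ only by a subset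
  of the countable set \<open>Z\<close>, and monotonicity of \<open>hausdorff1\<close> removes any
  need to know that \<open>EA\<close> is Borel.\<close>

lemma length_measure_eq:
  assumes A: "A \<in> sets (restrict_space borel S1p)"
  shows "length_measure L A = emeasure normal_measure A"
proof -
  have AS: "A \<subseteq> S1p" using sets.sets_into_space[OF A] by (simp add: space_restrict_space)
  define EA where "EA = {s \<in> {-1..1}. \<exists>u\<in>A. outer_unit_normal L (gam s) u}"
  define NA where "NA = N -` A \<inter> {-1..1}"
  \<comment> \<open>The end points are included because uniqueness of the normal compares with
    \<open>G\<close> on both sides.\<close>
  define Z where "Z = {s \<in> {-1..1}. \<not> isCont G s} \<union> {-1, 1}"
  have pre: "N -` A \<in> sets borel"
    using measurable_sets[OF measurable_N A] by simp
  then have NA: "NA \<in> sets borel" by (simp add: NA_def)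
  have "Z \<subseteq> {s. \<not> isCont G s} \<union> {-1,1}" by (auto simp: Z_def)
  then have Zc: "countable Z" by (rule countable_subset) (simp add: countable_discont)
  then have Z: "Z \<in> sets borel" by (auto intro: sets.countable)
  have "NA \<subseteq> EA" using outer_normal_N unfolding NA_def EA_def by blast
  moreover have "EA \<subseteq> NA \<union> Z"
  proof
    fix s assume "s \<in> EA"
    then obtain u where u: "s \<in> {-1..1}" "u \<in> A" "outer_unit_normal L (gam s) u" by (auto simp: EA_def)
    show "s \<in> NA \<union> Z"
    proof (cases "s \<in> Z")
      case False
      then have "u = N s" using u AS by (intro normal_unique) (auto simp: Z_def)
      then show ?thesis using u by (auto simp: NA_def)
    qed simp
  qed
  ultimately have "hausdorff1 (gam ` NA) \<le> hausdorff1 (gam ` EA)"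
    "hausdorff1 (gam ` EA) \<le> hausdorff1 (gam ` (NA \<union> Z))"
    by (auto intro!: hausdorff1_mono)
  moreover have "hausdorff1 (gam ` (NA \<union> Z)) = emeasure nu (NA \<union> Z)"
    using NA Z by (intro hausdorff1_gam) (auto simp: NA_def Z_def)
  moreover have "\<dots> \<le> emeasure nu NA + emeasure nu Z"
    using NA Z by (intro emeasure_subadditive) auto
  moreover have "emeasure nu Z = 0" by (rule nu_countable[OF Zc])
  moreover have "hausdorff1 (gam ` NA) = emeasure nu NA"
    using NA by (intro hausdorff1_gam) (auto simp: NA_def)
  ultimately have "hausdorff1 (gam ` EA) = emeasure nu NA" by auto
  also have "\<dots> = emeasure nu (N -` A)"
    using pre by (simp add: emeasure_nu NA_def Int_ac)
  also have "\<dots> = emeasure normal_measure A"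
    using A by (simp add: normal_measure_def emeasure_distr)
  finally show ?thesis
    unfolding length_measure_def normal_points_eq[OF AS] EA_def .
qed

text \<open>Multiplied by the speed, the integrand is \<open>f\<close>. Left of the maximiser
  \<open>s0\<close> its maximum is the term with \<open>u1\<close>, right of it the term with
  \<open>u2\<close>. The two integrals are the total rise of the first coordinate up to
  \<open>s0\<close> and the total drop of the second one after it, that is, the coordinates of
  \<open>gam s0\<close>.\<close>

lemma support_fun_eq:
  assumes u: "0 \<le> u1" "0 \<le> u2"
  shows "support_fun L (u1, u2) = (\<integral>a. max (fst a * u2) (snd a * u1) \<partial>normal_measure)"
proof -
  define f where "f s = max ((1 - G s) / 2 * u2) ((1 + G s) / 2 * u1)" for s
  have Lne: "L \<noteq> {}" using gam_in[of 0] by auto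
  have "continuous_on L (\<lambda>x. inner x (u1, u2))" by (intro continuous_intros)
  then obtain x where x: "x \<in> L" "\<And>y. y \<in> L \<Longrightarrow> inner y (u1, u2) \<le> inner x (u1, u2)"
    using continuous_attains_sup[OF compact_L Lne] by blast
  define s0 where "s0 = fst x - snd x"
  have s0: "s0 \<in> {-1..1}" using x(1) L_unit by (cases x) (auto simp: s0_def)
  have ge: "inner x (u1, u2) \<le> inner (gam s0) (u1, u2)"
    using gam_dominates[OF x(1)] u by (auto simp: inner_prod_def s0_def intro!: add_mono mult_right_mono)
  have mx: "inner y (u1, u2) \<le> inner (gam s0) (u1, u2)" if "y \<in> L" for y using x(2)[OF that] ge by simp
  have sup: "support_fun L (u1, u2) = inner (gam s0) (u1, u2)"
    unfolding support_fun_def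
    by (rule cSup_eq_maximum) (use mx gam_in[OF s0] in auto)
  have opt: "(u1 + u2) * (g t - g s0) + (u1 - u2) * (t - s0) \<le> 0" if "t \<in> {-1..1}" for t
    using mx[OF gam_in[OF that]] by (simp add: gam_def field_simps)
  have left: "f s = (1 + G s) / 2 * u1" if "-1 \<le> s" "s < s0" for s
  proof -
    have "(u1 + u2) * (g s0 - g s) \<le> (u1 + u2) * ((s0 - s) * G s)"
      using that s0 u g_diff(2)[of s s0] by (intro mult_left_mono) auto
    then have "0 \<le> (s0 - s) * ((u1 + u2) * G s + (u1 - u2))"
      using opt[of s] that s0 by (simp add: algebra_simps)
    then have "0 \<le> (u1 + u2) * G s + (u1 - u2)" using that by (simp add: zero_le_mult_iff)
    then show ?thesis by (simp add: f_def max_def field_simps)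
  qed
  have right: "f s = (1 - G s) / 2 * u2" if "s0 < s" "s \<le> 1" for s
  proof -
    have "(u1 + u2) * ((s - s0) * G s) \<le> (u1 + u2) * (g s - g s0)"
      using that s0 u g_diff(1)[of s0 s] by (intro mult_left_mono) auto
    then have "(s - s0) * ((u1 + u2) * G s + (u1 - u2)) \<le> 0"
      using opt[of s] that s0 by (simp add: algebra_simps)
    then have "(u1 + u2) * G s + (u1 - u2) \<le> 0" using that by (simp add: mult_le_0_iff)
    then show ?thesis by (simp add: f_def max_def field_simps)
  qed
  have Gint: "(G has_integral (g b - g a)) {a..b}" if "-1 \<le> a" "a \<le> b" "b \<le> 1" for a b
  proof (rule has_integral_by_slope_bounds[where lo = "\<lambda>s t. G t" and up = "\<lambda>s t. G s" and M = "\<lambda>s. - G s"])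
    show "G integrable_on {a..b}"
      using integrable_neg[OF integrable_on_mono_on[of a b "\<lambda>s. - G s"]] by (simp add: mono_on_def antimono_G)
  qed (use that antimono_G g_diff in auto)
  \<comment> \<open>The square has a single point with coordinate difference -1, namely (0,1), where
    the arc starts; likewise it ends at (1,0).\<close>
  have e1: "g (-1) = 1"
  proof -
    have "gam (-1) \<in> {0..1} \<times> {0..1}" using gam_in[of "-1"] L_unit by auto
    then show ?thesis by (simp add: gam_def)
  qed
  have e2: "g 1 = 1"
  proof -
    have "gam 1 \<in> {0..1} \<times> {0..1}" using gam_in[of "1"] L_unit by auto
    then show ?thesis by (simp add: gam_def)
  qed
  have c: "((\<lambda>r. k) has_integral (b - a) * k) {a..b}" if "a \<le> b" for a b k :: real
    using has_integral_const_real[of k a b] that by simp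
  have I1: "((\<lambda>s. (1 + G s) / 2 * u1) has_integral fst (gam s0) * u1) {-1..s0}"
    using has_integral_mult_left[OF has_integral_divide[OF has_integral_add[OF c[of "-1" s0 1] Gint[of "-1" s0]]], of 2 u1] s0
    by (simp add: e1 gam_def algebra_simps)
  have I2: "((\<lambda>s. (1 - G s) / 2 * u2) has_integral snd (gam s0) * u2) {s0..1}"
    using has_integral_mult_left[OF has_integral_divide[OF has_integral_diff[OF c[of s0 1 1] Gint[of s0 1]]], of 2 u2] s0
    by (simp add: e2 gam_def algebra_simps)
  have J1: "(f has_integral fst (gam s0) * u1) {-1..s0}"
    by (rule has_integral_spike_finite[OF _ _ I1, of "{s0}"]) (use left s0 in auto)
  have J2: "(f has_integral snd (gam s0) * u2) {s0..1}"
    by (rule has_integral_spike_finite[OF _ _ I2, of "{s0}"]) (use right s0 in auto)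
  have J: "(f has_integral support_fun L (u1, u2)) {-1..1}"
    unfolding sup using has_integral_combine[OF _ _ J1 J2] s0 by (simp add: inner_prod_def)
  have [measurable]: "f \<in> borel_measurable borel" unfolding f_def[abs_def] by measurable
  have fb: "\<bar>f s\<bar> \<le> u1 + u2" for s
  proof -
    have "0 \<le> (1 - G s) / 2 * u2 \<and> (1 - G s) / 2 * u2 \<le> 1 * u2"
      using u G_bounds[of s] by (intro conjI mult_right_mono mult_nonneg_nonneg) auto
    moreover have "0 \<le> (1 + G s) / 2 * u1 \<and> (1 + G s) / 2 * u1 \<le> 1 * u1"
      using u G_bounds[of s] by (intro conjI mult_right_mono mult_nonneg_nonneg) auto
    ultimately show ?thesis using u unfolding f_def by linarith
  qed
  have "set_integrable lborel {-1..1} f"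
    unfolding set_integrable_def
    by (rule integrableI_bounded_set_indicator[where B = "u1 + u2"]) (use fb in auto)
  then have "(LINT s:{-1..1}|lborel. f s) = support_fun L (u1, u2)"
    using set_borel_integral_eq_integral(2) J by (metis integral_unique)
  moreover have "(\<integral>a. max (fst a * u2) (snd a * u1) \<partial>normal_measure) =
     (\<integral>s. max (fst (N s) * u2) (snd (N s) * u1) \<partial>nu)"
    unfolding normal_measure_def
    by (rule integral_distr) (auto intro!: measurable_restrict_space1 borel_measurable_continuous_onI continuous_intros)
  moreover have "\<dots> = (\<integral>s. (spd s * indicator {-1..1} s) *\<^sub>R max (fst (N s) * u2) (snd (N s) * u1) \<partial>lborel)"
  proof -
    have "nu = density lborel (\<lambda>s. ennreal (spd s * indicator {-1..1} s))"
      unfolding nu_def by (intro arg_cong2[of _ _ _ _ density]) (auto simp: indicator_def)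
    moreover have "(\<lambda>s. max (fst (N s) * u2) (snd (N s) * u1)) \<in> borel_measurable lborel"
      unfolding N_def by measurable
    ultimately show ?thesis
      using less_imp_le[OF spd_pos] by (simp add: integral_density)
  qed
  moreover have "(spd s * indicator {-1..1} s) *\<^sub>R max (fst (N s) * u2) (snd (N s) * u1) = indicator {-1..1} s *\<^sub>R f s" for s
  proof -
    have "spd s * max (fst (N s) * u2) (snd (N s) * u1) = f s"
      using spd_pos[of s] by (simp add: f_def N_def max_mult_distrib_left)
    then show ?thesis by (auto simp: indicator_def)
  qed
  ultimately show ?thesis unfolding set_lebesgue_integral_def by (simp only:)
qed

end

section \<open>Uniqueness of the spectral measure\<close>

locale angular_measure = finite_measure \<sigma> for \<sigma> :: "(real \<times> real) measure" +
  assumes sets_eq: "sets \<sigma> = sets (restrict_space borel S1p)"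
begin

lemma space_eq: "space \<sigma> = S1p"
  using sets_eq_imp_space_eq[OF sets_eq] by (simp add: space_restrict_space)

lemma borel_measurable_sigma: "f \<in> borel_measurable borel \<Longrightarrow> f \<in> borel_measurable \<sigma>"
  using measurable_restrict_space1[of f borel borel S1p] measurable_cong_sets[OF sets_eq refl] by blast

lemma fst_measurable [measurable]: "fst \<in> borel_measurable \<sigma>"
  and snd_measurable [measurable]: "snd \<in> borel_measurable \<sigma>"
  by (auto intro!: borel_measurable_sigma borel_measurable_continuous_onI continuous_intros)

lemma coord_bounds: "a \<in> space \<sigma> \<Longrightarrow> 0 \<le> fst a \<and> fst a \<le> 1 \<and> 0 \<le> snd a \<and> snd a \<le> 1"
  using S1p_bounds by (simp add: space_eq)

lemma integrable_bounded:
  fixes f :: "real \<times> real \<Rightarrow> real"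
  assumes "f \<in> borel_measurable \<sigma>" "\<And>a. a \<in> space \<sigma> \<Longrightarrow> \<bar>f a\<bar> \<le> B"
  shows "integrable \<sigma> f"
  by (rule integrable_const_bound[of _ B]) (use assms in auto)

lemma abs_coord: "a \<in> space \<sigma> \<Longrightarrow> \<bar>fst a\<bar> \<le> 1" "a \<in> space \<sigma> \<Longrightarrow> \<bar>snd a\<bar> \<le> 1"
  using coord_bounds by fastforce+

lemma integrable_fst [intro, simp]: "integrable \<sigma> fst" and integrable_snd [intro, simp]: "integrable \<sigma> snd"
  by (rule integrable_bounded[of _ 1]; use abs_coord in auto)+

lemma integrable_max [intro, simp]: "integrable \<sigma> (\<lambda>a. max (fst a * s) (snd a * t))"
proof -
  have "\<bar>max (fst a * s) (snd a * t)\<bar> \<le> \<bar>s\<bar> + \<bar>t\<bar>" if "a \<in> space \<sigma>" for a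
  proof -
    have "\<bar>fst a * s\<bar> \<le> 1 * \<bar>s\<bar>" "\<bar>snd a * t\<bar> \<le> 1 * \<bar>t\<bar>"
      unfolding abs_mult by (intro mult_right_mono abs_coord that; simp)+
    then show ?thesis by linarith
  qed
  then show ?thesis by (rule integrable_bounded[rotated]) measurable
qed

lemma integrable_fst_indicator [intro, simp]:
  assumes "Measurable.pred \<sigma> P" shows "integrable \<sigma> (\<lambda>a. fst a * of_bool (P a))"
  by (rule integrable_bounded[of _ 1]) (use assms abs_coord in \<open>auto simp: of_bool_def\<close>)

lemma integrable_snd_indicator [intro, simp]:
  assumes "Measurable.pred \<sigma> P" shows "integrable \<sigma> (\<lambda>a. snd a * of_bool (P a))"
  by (rule integrable_bounded[of _ 1]) (use assms abs_coord in \<open>auto simp: of_bool_def\<close>)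

text \<open>This is the right derivative in \<open>t\<close> of the integral of max(a1, a2 t).
  Pointwise the quotient equals a2 if a1 \<le> a2 t and is eventually 0 otherwise; approaching from
  the right counts ties. The quotients are dominated by 1.\<close>

lemma snd_below_limit:
  assumes "0 \<le> t"
  shows "(\<lambda>n. real (Suc n) * ((\<integral>a. max (fst a * 1) (snd a * (t + 1 / real (Suc n))) \<partial>\<sigma>)
      - (\<integral>a. max (fst a * 1) (snd a * t) \<partial>\<sigma>)))
    \<longlonglongrightarrow> (\<integral>a. snd a * of_bool (fst a \<le> snd a * t) \<partial>\<sigma>)"
proof -
  define f where "f n a = real (Suc n) * (max (fst a) (snd a * (t + 1 / real (Suc n))) - max (fst a) (snd a * t))"
    for n and a :: "real \<times> real"
  have "(\<lambda>n. \<integral>a. f n a \<partial>\<sigma>) \<longlonglongrightarrow> (\<integral>a. snd a * of_bool (fst a \<le> snd a * t) \<partial>\<sigma>)"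
  proof (rule integral_dominated_convergence[where w = "\<lambda>_. 1"])
    show "AE a in \<sigma>. (\<lambda>n. f n a) \<longlonglongrightarrow> snd a * of_bool (fst a \<le> snd a * t)"
    proof (rule AE_I2)
      fix a assume a: "a \<in> space \<sigma>"
      note b = coord_bounds[OF a]
      show "(\<lambda>n. f n a) \<longlonglongrightarrow> snd a * of_bool (fst a \<le> snd a * t)"
      proof (cases "fst a \<le> snd a * t")
        case True
        have "f n a = snd a" for n
        proof -
          have "snd a * t \<le> snd a * (t + 1 / real (Suc n))" using b by (intro mult_left_mono) auto
          with True have "f n a = real (Suc n) * (snd a * (t + 1 / real (Suc n)) - snd a * t)"
            unfolding f_def by (simp only: max_absorb2 order_trans)
          also have "\<dots> = snd a" by (simp add: algebra_simps del: of_nat_Suc)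
          finally show ?thesis .
        qed
        then show ?thesis using True by simp
      next
        case False
        have "(\<lambda>n. snd a * (t + 1 / real (Suc n))) \<longlonglongrightarrow> snd a * (t + 0)"
          by (intro tendsto_intros LIMSEQ_Suc[OF lim_1_over_n])
        then have "\<forall>\<^sub>F n in sequentially. snd a * (t + 1 / real (Suc n)) < fst a"
          using False by (intro order_tendstoD(2)) auto
        then have "\<forall>\<^sub>F n in sequentially. f n a = 0"
          by eventually_elim (use False in \<open>simp add: f_def max_def\<close>)
        then show ?thesis using False by (simp add: tendsto_eventually)
      qed
    qed
    show "AE a in \<sigma>. norm (f n a) \<le> 1" for n
    proof (rule AE_I2)
      fix a assume a: "a \<in> space \<sigma>"
      note b = coord_bounds[OF a]
      have "snd a * t \<le> snd a * (t + 1 / real (Suc n))" using b by (intro mult_left_mono) auto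
      then have "0 \<le> max (fst a) (snd a * (t + 1 / real (Suc n))) - max (fst a) (snd a * t)"
        "max (fst a) (snd a * (t + 1 / real (Suc n))) - max (fst a) (snd a * t) \<le> snd a * (t + 1 / real (Suc n)) - snd a * t"
        by linarith+
      moreover have "snd a * (t + 1 / real (Suc n)) - snd a * t = snd a / real (Suc n)"
        by (simp add: algebra_simps del: of_nat_Suc)
      ultimately have "0 \<le> f n a" "f n a \<le> real (Suc n) * (snd a / real (Suc n))"
        unfolding f_def by (intro mult_nonneg_nonneg mult_left_mono; simp)+
      then show "norm (f n a) \<le> 1" using b by simp
    qed
    show "f n \<in> borel_measurable \<sigma>" for n unfolding f_def[abs_def] by measurable
  qed auto
  moreover have "(\<integral>a. f n a \<partial>\<sigma>) = real (Suc n) * ((\<integral>a. max (fst a * 1) (snd a * (t + 1 / real (Suc n))) \<partial>\<sigma>)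
      - (\<integral>a. max (fst a * 1) (snd a * t) \<partial>\<sigma>))" for n
    unfolding f_def integral_mult_right_zero
    using Bochner_Integration.integral_diff[OF integrable_max[of 1 "t + 1 / real (Suc n)"] integrable_max[of 1 t]] by simp
  ultimately show ?thesis by simp
qed

text \<open>On the set a1 \<le> a2 t the maximum is a2 t, elsewhere it is a1, so the part weighted
  by a1 follows from known quantities. Weight a2 alone would not see mass at (1,0).\<close>

lemma sum_below_eq:
  "(\<integral>a. (fst a + snd a) * of_bool (fst a \<le> snd a * t) \<partial>\<sigma>) =
   (1 + t) * (\<integral>a. snd a * of_bool (fst a \<le> snd a * t) \<partial>\<sigma>) + (\<integral>a. fst a \<partial>\<sigma>)
     - (\<integral>a. max (fst a * 1) (snd a * t) \<partial>\<sigma>)"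
proof -
  have p: "Measurable.pred \<sigma> (\<lambda>a. fst a \<le> snd a * t)" by measurable
  have "(\<integral>a. (fst a + snd a) * of_bool (fst a \<le> snd a * t) \<partial>\<sigma>) =
    (\<integral>a. ((1 + t) * (snd a * of_bool (fst a \<le> snd a * t)) + fst a) - max (fst a * 1) (snd a * t) \<partial>\<sigma>)"
    by (intro Bochner_Integration.integral_cong) (auto simp: max_def algebra_simps)
  also have "\<dots> = (\<integral>a. (1 + t) * (snd a * of_bool (fst a \<le> snd a * t)) + fst a \<partial>\<sigma>) - (\<integral>a. max (fst a * 1) (snd a * t) \<partial>\<sigma>)"
    by (intro Bochner_Integration.integral_diff Bochner_Integration.integrable_add integrable_mult_right
        integrable_snd_indicator integrable_fst integrable_max p)
  also have "(\<integral>a. (1 + t) * (snd a * of_bool (fst a \<le> snd a * t)) + fst a \<partial>\<sigma>) =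
     (\<integral>a. (1 + t) * (snd a * of_bool (fst a \<le> snd a * t)) \<partial>\<sigma>) + (\<integral>a. fst a \<partial>\<sigma>)"
    by (intro Bochner_Integration.integral_add integrable_mult_right integrable_snd_indicator integrable_fst p)
  finally show ?thesis by simp
qed

text \<open>The first coordinate parametrises the arc, and the weight a1 + a2 is positive there, so
  \<sigma> can be recovered from this measure on the line.\<close>

definition coord_measure :: "real measure" where
  "coord_measure = distr (density \<sigma> (\<lambda>a. ennreal (fst a + snd a))) borel fst"

lemma emeasure_coord_atMost:
  "emeasure coord_measure {..c} = ennreal (\<integral>a. (fst a + snd a) * of_bool (fst a \<le> c) \<partial>\<sigma>)"
proof -
  have "emeasure coord_measure {..c} = (\<integral>\<^sup>+a. ennreal (fst a + snd a) * indicator (fst -` {..c} \<inter> space \<sigma>) a \<partial>\<sigma>)"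
    unfolding coord_measure_def by (subst emeasure_distr) (auto simp: emeasure_density)
  also have "\<dots> = (\<integral>\<^sup>+a. ennreal ((fst a + snd a) * of_bool (fst a \<le> c)) \<partial>\<sigma>)"
    by (intro nn_integral_cong) (auto simp: indicator_def)
  also have "\<dots> = ennreal (\<integral>a. (fst a + snd a) * of_bool (fst a \<le> c) \<partial>\<sigma>)"
  proof (rule nn_integral_eq_integral)
    show "integrable \<sigma> (\<lambda>a. (fst a + snd a) * of_bool (fst a \<le> c))"
    proof (rule integrable_bounded)
      show "\<bar>(fst a + snd a) * of_bool (fst a \<le> c)\<bar> \<le> 2" if "a \<in> space \<sigma>" for a
        using coord_bounds[OF that] by (auto simp: of_bool_def)
    qed measurable
    show "AE a in \<sigma>. 0 \<le> (fst a + snd a) * of_bool (fst a \<le> c)"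
      using coord_bounds by (intro AE_I2) (auto simp: of_bool_def)
  qed
  finally show ?thesis .
qed

lemma coord_measure_finite: "finite_borel_measure coord_measure"
proof -
  have "emeasure coord_measure UNIV = emeasure coord_measure {..1}"
    unfolding coord_measure_def using coord_bounds
    by (simp add: emeasure_distr) (intro arg_cong[of _ _ "emeasure _"]; auto)
  then have "finite_measure coord_measure"
    by (intro finite_measureI) (simp add: emeasure_coord_atMost, simp add: coord_measure_def)
  then show ?thesis
    by (simp add: finite_borel_measure_def finite_borel_measure_axioms_def coord_measure_def)
qed

lemma emeasure_via_coord:
  assumes A: "A \<in> sets \<sigma>"
  shows "emeasure \<sigma> A = (\<integral>\<^sup>+c. indicator A (c, sqrt (1 - c\<^sup>2)) * inverse (ennreal (c + sqrt (1 - c\<^sup>2))) \<partial>coord_measure)"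
proof -
  have "A \<in> sets borel"
    using A closed_S1p unfolding sets_eq by (auto simp: sets_restrict_space)
  then have [measurable]: "(\<lambda>c. indicator A (c, sqrt (1 - c\<^sup>2)) * inverse (ennreal (c + sqrt (1 - c\<^sup>2)))) \<in> borel_measurable borel"
    unfolding borel_prod[symmetric] by measurable
  have "emeasure \<sigma> A = (\<integral>\<^sup>+a. indicator A a \<partial>\<sigma>)" using A by simp
  also have "\<dots> = (\<integral>\<^sup>+a. ennreal (fst a + snd a) * (indicator A (fst a, sqrt (1 - (fst a)\<^sup>2)) * inverse (ennreal (fst a + sqrt (1 - (fst a)\<^sup>2)))) \<partial>\<sigma>)"
  proof (rule nn_integral_cong)
    fix a assume a: "a \<in> space \<sigma>"
    have sq: "(fst a)\<^sup>2 + (snd a)\<^sup>2 = 1" "0 \<le> snd a" "0 \<le> fst a" using a by (auto simp: space_eq S1p_def)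
    then have s: "sqrt (1 - (fst a)\<^sup>2) = snd a" by (intro real_sqrt_unique) auto
    have pos: "0 < fst a + snd a" using sq by (smt (verit) power_zero_numeral zero_neq_one)
    then have "ennreal (fst a + snd a) * inverse (ennreal (fst a + snd a)) = 1"
      by (simp add: inverse_ennreal ennreal_mult'[symmetric])
    then show "indicator A a = ennreal (fst a + snd a) * (indicator A (fst a, sqrt (1 - (fst a)\<^sup>2)) * inverse (ennreal (fst a + sqrt (1 - (fst a)\<^sup>2))))"
      unfolding s by (auto simp: indicator_def)
  qed
  also have "\<dots> = (\<integral>\<^sup>+c. indicator A (c, sqrt (1 - c\<^sup>2)) * inverse (ennreal (c + sqrt (1 - c\<^sup>2))) \<partial>coord_measure)"
    unfolding coord_measure_def by (subst nn_integral_distr) (auto simp: nn_integral_density)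
  finally show ?thesis .
qed

text \<open>On the arc a bound \<open>c\<close> < 1 on a1 is the bound c / sqrt(1 - c^2) on the
  ratio a1/a2. At c = 1 that ratio becomes infinite and the total mass takes over.\<close>

lemma cdf_coord:
  "cdf coord_measure c = (if c < 0 then 0 else if c < 1
      then \<integral>a. (fst a + snd a) * of_bool (fst a \<le> snd a * (c / sqrt (1 - c\<^sup>2))) \<partial>\<sigma>
      else \<integral>a. fst a + snd a \<partial>\<sigma>)"
proof -
  have "cdf coord_measure c = (\<integral>a. (fst a + snd a) * of_bool (fst a \<le> c) \<partial>\<sigma>)"
    unfolding cdf_def measure_def emeasure_coord_atMost
    by (intro enn2real_ennreal Bochner_Integration.integral_nonneg_AE AE_I2) (use coord_bounds in \<open>auto simp: of_bool_def\<close>)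
  also have "\<dots> = (if c < 0 then 0 else if c < 1
      then \<integral>a. (fst a + snd a) * of_bool (fst a \<le> snd a * (c / sqrt (1 - c\<^sup>2))) \<partial>\<sigma>
      else \<integral>a. fst a + snd a \<partial>\<sigma>)"
  proof -
    consider "c < 0" | "0 \<le> c" "c < 1" | "1 \<le> c" by linarith
    then show ?thesis
    proof cases
      case 1
      then have "(\<integral>a. (fst a + snd a) * of_bool (fst a \<le> c) \<partial>\<sigma>) = (\<integral>a. 0 \<partial>\<sigma>)"
        by (intro Bochner_Integration.integral_cong) (use coord_bounds in force)+
      then show ?thesis using 1 by simp
    next
      case 2
      define r where "r = sqrt (1 - c\<^sup>2)"
      have c2: "c\<^sup>2 < 1" using 2 by (simp add: abs_square_less_1)
      then have r: "0 < r" "r\<^sup>2 = 1 - c\<^sup>2" by (auto simp: r_def)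
      have "fst a \<le> c \<longleftrightarrow> fst a \<le> snd a * (c / r)" if "a \<in> space \<sigma>" for a
      proof -
        have sq: "(fst a)\<^sup>2 + (snd a)\<^sup>2 = 1" "0 \<le> snd a" "0 \<le> fst a" using that by (auto simp: space_eq S1p_def)
        show ?thesis
        proof (cases "fst a \<le> c")
          case True
          then have "(fst a)\<^sup>2 \<le> c\<^sup>2" using sq by (intro power_mono) auto
          then have "r\<^sup>2 \<le> (snd a)\<^sup>2" using r(2) sq(1) by linarith
          then have "r \<le> snd a" using sq(2) by (rule power2_le_imp_le)
          then have "r * (c / r) \<le> snd a * (c / r)" using 2 r by (intro mult_right_mono) auto
          then show ?thesis using True r(1) by simp
        next
          case False
          then have "c\<^sup>2 \<le> (fst a)\<^sup>2" using 2 by (intro power_mono) auto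
          then have "(snd a)\<^sup>2 \<le> r\<^sup>2" using r(2) sq(1) by linarith
          then have "snd a \<le> r" using less_imp_le[OF r(1)] by (rule power2_le_imp_le)
          then have "snd a * (c / r) \<le> r * (c / r)" using 2 r by (intro mult_right_mono) auto
          then show ?thesis using False r(1) by simp
        qed
      qed
      then have "(\<integral>a. (fst a + snd a) * of_bool (fst a \<le> c) \<partial>\<sigma>) =
        (\<integral>a. (fst a + snd a) * of_bool (fst a \<le> snd a * (c / r)) \<partial>\<sigma>)"
        by (intro Bochner_Integration.integral_cong) auto
      then show ?thesis using 2 by (simp add: r_def)
    next
      case 3
      then have "(\<integral>a. (fst a + snd a) * of_bool (fst a \<le> c) \<partial>\<sigma>) = (\<integral>a. fst a + snd a \<partial>\<sigma>)"
        by (intro Bochner_Integration.integral_cong) (use coord_bounds in force)+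
      then show ?thesis using 3 by simp
    qed
  qed
  finally show ?thesis .
qed

lemma integral_fst_eq_max: "(\<integral>a. fst a \<partial>\<sigma>) = (\<integral>a. max (fst a * 1) (snd a * 0) \<partial>\<sigma>)"
  and integral_snd_eq_max: "(\<integral>a. snd a \<partial>\<sigma>) = (\<integral>a. max (fst a * 0) (snd a * 1) \<partial>\<sigma>)"
  by (intro Bochner_Integration.integral_cong; use coord_bounds in force)+

end

lemma angular_measure_eqI:
  assumes "angular_measure \<sigma>" "angular_measure \<tau>"
    and eq: "\<And>s t. 0 \<le> s \<Longrightarrow> 0 \<le> t \<Longrightarrow>
      (\<integral>a. max (fst a * s) (snd a * t) \<partial>\<sigma>) = (\<integral>a. max (fst a * s) (snd a * t) \<partial>\<tau>)"
  shows "\<sigma> = \<tau>"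
proof -
  interpret S: angular_measure \<sigma> by fact
  interpret T: angular_measure \<tau> by fact
  have f: "(\<integral>a. fst a \<partial>\<sigma>) = (\<integral>a. fst a \<partial>\<tau>)" "(\<integral>a. snd a \<partial>\<sigma>) = (\<integral>a. snd a \<partial>\<tau>)"
    unfolding S.integral_fst_eq_max T.integral_fst_eq_max S.integral_snd_eq_max T.integral_snd_eq_max
    by (intro eq; simp)+
  have "(\<integral>a. snd a * of_bool (fst a \<le> snd a * t) \<partial>\<sigma>) = (\<integral>a. snd a * of_bool (fst a \<le> snd a * t) \<partial>\<tau>)" if "0 \<le> t" for t
  proof (rule LIMSEQ_unique[OF S.snd_below_limit[OF that]])
    have "(\<integral>a. max (fst a * 1) (snd a * s) \<partial>\<sigma>) = (\<integral>a. max (fst a * 1) (snd a * s) \<partial>\<tau>)" if "0 \<le> s" for s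
      using that by (intro eq) auto
    then show "(\<lambda>n. real (Suc n) * ((\<integral>a. max (fst a * 1) (snd a * (t + 1 / real (Suc n))) \<partial>\<sigma>)
      - (\<integral>a. max (fst a * 1) (snd a * t) \<partial>\<sigma>)))
       \<longlonglongrightarrow> (\<integral>a. snd a * of_bool (fst a \<le> snd a * t) \<partial>\<tau>)"
      using T.snd_below_limit[OF that] that by simp
  qed
  then have "(\<integral>a. (fst a + snd a) * of_bool (fst a \<le> snd a * t) \<partial>\<sigma>) =
      (\<integral>a. (fst a + snd a) * of_bool (fst a \<le> snd a * t) \<partial>\<tau>)" if "0 \<le> t" for t
    unfolding S.sum_below_eq T.sum_below_eq using that f eq[of 1 t] by simp
  note below = this
  have total: "(\<integral>a. fst a + snd a \<partial>\<sigma>) = (\<integral>a. fst a + snd a \<partial>\<tau>)"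
    using f by simp
  have "cdf S.coord_measure c = cdf T.coord_measure c" for c
    unfolding S.cdf_coord T.cdf_coord
    by (intro if_cong refl below total divide_nonneg_nonneg real_sqrt_ge_zero)
      (auto simp: not_less abs_square_le_1)
  then have "cdf S.coord_measure = cdf T.coord_measure" by auto
  then have "S.coord_measure = T.coord_measure"
    by (rule cdf_unique'[OF S.coord_measure_finite T.coord_measure_finite])
  then show ?thesis
    by (intro measure_eqI) (auto simp: S.sets_eq T.sets_eq S.emeasure_via_coord T.emeasure_via_coord)
qed

section \<open>Existence of max-stable vectors\<close>

locale spectral_angular = angular_measure +
  assumes mean_fst: "(\<integral>a. fst a \<partial>\<sigma>) = 1" and mean_snd: "(\<integral>a. snd a \<partial>\<sigma>) = 1"
begin

text \<open>The exponent of the distribution function at (1/t, 1/c), up to sign.\<close>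

definition ell :: "real \<Rightarrow> real \<Rightarrow> real" where
  "ell c t = (\<integral>a. max (fst a * t) (snd a * c) \<partial>\<sigma>)"

text \<open>The right derivative of \<open>ell c\<close> at \<open>t\<close>; it enters only as a
  supporting slope of this convex function.\<close>

definition slope :: "real \<Rightarrow> real \<Rightarrow> real" where
  "slope c t = (\<integral>a. fst a * of_bool (snd a * c \<le> fst a * t) \<partial>\<sigma>)"

lemma pred_slope: "Measurable.pred \<sigma> (\<lambda>a. snd a * c \<le> fst a * t)"
  by measurable

lemma mean_fst_times: "(\<integral>a. fst a * t \<partial>\<sigma>) = t"
  and mean_snd_times: "(\<integral>a. snd a * t \<partial>\<sigma>) = t"
  by (simp_all add: mean_fst mean_snd)

lemma slope_mono: "s \<le> t \<Longrightarrow> slope c s \<le> slope c t"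
  unfolding slope_def
proof (intro integral_mono integrable_fst_indicator pred_slope)
  fix a assume a: "a \<in> space \<sigma>" "s \<le> t"
  then have "fst a * s \<le> fst a * t" using coord_bounds by (intro mult_left_mono) auto
  then show "fst a * of_bool (snd a * c \<le> fst a * s) \<le> fst a * of_bool (snd a * c \<le> fst a * t)"
    using coord_bounds[OF a(1)] by (auto simp: of_bool_def)
qed

lemma slope_antimono: "c \<le> d \<Longrightarrow> slope d t \<le> slope c t"
  unfolding slope_def
proof (intro integral_mono integrable_fst_indicator pred_slope)
  fix a assume a: "a \<in> space \<sigma>" "c \<le> d"
  then have "snd a * c \<le> snd a * d" using coord_bounds by (intro mult_left_mono) auto
  then show "fst a * of_bool (snd a * d \<le> fst a * t) \<le> fst a * of_bool (snd a * c \<le> fst a * t)"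
    using coord_bounds[OF a(1)] by (auto simp: of_bool_def)
qed

lemma slope_nonneg: "0 \<le> slope c t"
  unfolding slope_def by (intro Bochner_Integration.integral_nonneg_AE AE_I2) (use coord_bounds in auto)

lemma slope_le_1: "slope c t \<le> 1"
  unfolding slope_def mean_fst[symmetric]
  by (intro integral_mono integrable_fst_indicator pred_slope integrable_fst) (use coord_bounds in \<open>auto simp: of_bool_def\<close>)

lemma ell_diff:
  assumes "s \<le> t"
  shows "(t - s) * slope c s \<le> ell c t - ell c s" "ell c t - ell c s \<le> (t - s) * slope c t"
proof -
  have d: "ell c t - ell c s = (\<integral>a. max (fst a * t) (snd a * c) - max (fst a * s) (snd a * c) \<partial>\<sigma>)"
    unfolding ell_def by (rule Bochner_Integration.integral_diff[symmetric]) auto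
  have e: "(t - s) * slope c r = (\<integral>a. (t - s) * (fst a * of_bool (snd a * c \<le> fst a * r)) \<partial>\<sigma>)" for r
    unfolding slope_def by simp
  have st: "fst a * s \<le> fst a * t" if "a \<in> space \<sigma>" for a
    using coord_bounds[OF that] assms by (intro mult_left_mono) auto
  show "(t - s) * slope c s \<le> ell c t - ell c s"
    unfolding d e using st
    by (intro integral_mono integrable_mult_right integrable_fst_indicator pred_slope
        Bochner_Integration.integrable_diff integrable_max) (force simp: of_bool_def max_def algebra_simps)
  show "ell c t - ell c s \<le> (t - s) * slope c t"
    unfolding d e using st
    by (intro integral_mono integrable_mult_right integrable_fst_indicator pred_slope
        Bochner_Integration.integrable_diff integrable_max) (force simp: of_bool_def max_def algebra_simps)
qed

lemma ell_mono: "s \<le> t \<Longrightarrow> ell c s \<le> ell c t"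
  using ell_diff(1)[of s t c] mult_nonneg_nonneg[OF _ slope_nonneg, of "t - s" c s] by simp

lemma ell_mono2: "c \<le> d \<Longrightarrow> ell c t \<le> ell d t"
  unfolding ell_def
proof (intro integral_mono integrable_max)
  fix a assume a: "a \<in> space \<sigma>" "c \<le> d"
  then have "snd a * c \<le> snd a * d" using coord_bounds by (intro mult_left_mono) auto
  then show "max (fst a * t) (snd a * c) \<le> max (fst a * t) (snd a * d)" by linarith
qed

lemma ell_ge: "t \<le> ell c t" "c \<le> ell c t"
proof -
  have "(\<integral>a. fst a * t \<partial>\<sigma>) \<le> ell c t" "(\<integral>a. snd a * c \<partial>\<sigma>) \<le> ell c t"
    unfolding ell_def by (intro integral_mono integrable_mult_left integrable_max integrable_fst integrable_snd; simp)+
  then show "t \<le> ell c t" "c \<le> ell c t" unfolding mean_fst_times mean_snd_times .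
qed

lemma ell_le:
  assumes "0 \<le> c" "0 \<le> t" shows "ell c t \<le> t + c"
proof -
  have "ell c t \<le> (\<integral>a. fst a * t + snd a * c \<partial>\<sigma>)"
    unfolding ell_def
    by (intro integral_mono integrable_mult_left integrable_max integrable_fst integrable_snd
        Bochner_Integration.integrable_add) (use coord_bounds assms in auto)
  also have "\<dots> = t + c" by (simp add: mean_fst_times mean_snd_times mean_fst mean_snd)
  finally show ?thesis .
qed

lemma borel_slope [measurable]: "slope c \<in> borel_measurable borel"
  and borel_ell [measurable]: "ell c \<in> borel_measurable borel"
  by (rule borel_measurable_mono; simp add: mono_def slope_mono ell_mono)+

text \<open>Both bounds come from 1 + d \<le> exp d, used at the increment \<open>d\<close> of
  \<open>ell\<close> and at its negative.\<close>

lemma exp_ell_diff: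
  assumes "s \<le> t"
  shows "(t - s) * (exp (- ell c t) * slope c s) \<le> exp (- ell c s) - exp (- ell c t)"
    "exp (- ell c s) - exp (- ell c t) \<le> (t - s) * (exp (- ell c s) * slope c t)"
proof -
  define d where "d = ell c t - ell c s"
  have d: "(t - s) * slope c s \<le> d" "d \<le> (t - s) * slope c t" using ell_diff[OF assms] by (auto simp: d_def)
  have "d \<le> exp d - 1" "1 - exp (- d) \<le> d" using exp_ge_add_one_self[of d] exp_ge_add_one_self[of "- d"] by linarith+
  then have "exp (- ell c t) * ((t - s) * slope c s) \<le> exp (- ell c t) * (exp d - 1)"
    "exp (- ell c s) * (1 - exp (- d)) \<le> exp (- ell c s) * ((t - s) * slope c t)"
    using d by (intro mult_left_mono; simp)+
  moreover have "exp (- ell c t) * (exp d - 1) = exp (- ell c s) - exp (- ell c t)"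
    "exp (- ell c s) * (1 - exp (- d)) = exp (- ell c s) - exp (- ell c t)"
    by (simp_all add: algebra_simps d_def flip: exp_add)
  ultimately show "(t - s) * (exp (- ell c t) * slope c s) \<le> exp (- ell c s) - exp (- ell c t)"
    "exp (- ell c s) - exp (- ell c t) \<le> (t - s) * (exp (- ell c s) * slope c t)"
    by (simp_all add: mult.left_commute)
qed

lemma has_integral_exp_ell:
  assumes "0 \<le> p" "p \<le> q"
  shows "((\<lambda>t. exp (- ell c t) * slope c t) has_integral (exp (- ell c p) - exp (- ell c q))) {p..q}"
proof -
  have bd: "\<bar>exp (- ell c t) * slope c t\<bar> \<le> 1" if "0 \<le> t" for t
    using ell_ge(1)[of t c] that slope_nonneg[of c t] slope_le_1[of c t]
    by (simp add: abs_mult mult_le_one)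
  have "set_integrable lborel {p..q} (\<lambda>t. exp (- ell c t) * slope c t)"
    unfolding set_integrable_def
    by (rule integrableI_bounded_set_indicator[where B = 1]) (use bd assms in auto)
  then have int: "(\<lambda>t. exp (- ell c t) * slope c t) integrable_on {p..q}"
    by (rule set_borel_integral_eq_integral(1))
  have "((\<lambda>t. exp (- ell c t) * slope c t) has_integral ((- exp (- ell c q)) - (- exp (- ell c p)))) {p..q}"
  \<comment> \<open>The exponential decreases and the slope increases, so the bounds combine
    opposite end points. \<open>M\<close> adds the two variations, both factors being at most
    1.\<close>
  proof (rule has_integral_by_slope_bounds[OF assms(2) int,
        where lo = "\<lambda>s t. exp (- ell c t) * slope c s" and up = "\<lambda>s t. exp (- ell c s) * slope c t"
        and M = "\<lambda>t. slope c t - exp (- ell c t)"])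
    fix s r t assume *: "p \<le> s" "s \<le> r" "r \<le> t" "t \<le> q"
    then show "exp (- ell c t) * slope c s \<le> exp (- ell c r) * slope c r \<and>
       exp (- ell c r) * slope c r \<le> exp (- ell c s) * slope c t"
      by (intro conjI mult_mono slope_mono slope_nonneg) (auto intro: ell_mono)
  next
    fix s t assume *: "p \<le> s" "s \<le> t" "t \<le> q"
    show "(t - s) * (exp (- ell c t) * slope c s) \<le> - exp (- ell c t) - - exp (- ell c s) \<and>
         - exp (- ell c t) - - exp (- ell c s) \<le> (t - s) * (exp (- ell c s) * slope c t)"
      using exp_ell_diff[OF *(2), of c] by simp
    have "exp (- ell c s) * (slope c t - slope c s) \<le> 1 * (slope c t - slope c s)"
      using slope_mono[OF *(2), of c] ell_ge(1)[of s c] * assms by (intro mult_right_mono) auto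
    moreover have "(exp (- ell c s) - exp (- ell c t)) * slope c s \<le> (exp (- ell c s) - exp (- ell c t)) * 1"
      using ell_mono[OF *(2), of c] slope_le_1[of c s] by (intro mult_left_mono) auto
    ultimately show "exp (- ell c s) * slope c t - exp (- ell c t) * slope c s \<le>
       slope c t - exp (- ell c t) - (slope c s - exp (- ell c s))"
      by (simp add: algebra_simps)
  qed
  then show ?thesis by simp
qed

text \<open>With c = 1/x2 and p = 1/x1 the right-hand side is the required distribution function at
  (x1, x2).\<close>

lemma nn_integral_exp_ell:
  assumes "0 \<le> p"
  shows "(\<integral>\<^sup>+t. ennreal (exp (- ell c t) * slope c t) * indicator {p..} t \<partial>lborel) = ennreal (exp (- ell c p))"
proof -
  define \<rho> where "\<rho> = density lborel (\<lambda>t. ennreal (exp (- ell c t) * slope c t))"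
  have [simp]: "sets \<rho> = sets borel" by (simp add: \<rho>_def)
  have fin: "emeasure \<rho> {p..p + real n} = ennreal (exp (- ell c p) - exp (- ell c (p + real n)))" for n
    unfolding \<rho>_def using nn_integral_has_integral_lebesgue'[OF _ has_integral_exp_ell[of p "p + real n" c]]
      slope_nonneg assms by (simp add: emeasure_density)
  have "incseq (\<lambda>n. {p..p + real n})" by (auto simp: incseq_def)
  then have "(\<lambda>n. emeasure \<rho> {p..p + real n}) \<longlonglongrightarrow> emeasure \<rho> (\<Union>n. {p..p + real n})"
    by (intro Lim_emeasure_incseq) auto
  moreover have "(\<Union>n. {p..p + real n}) = {p..}"
  proof (intro equalityI subsetI)
    fix x assume "x \<in> {p..}"
    then show "x \<in> (\<Union>n. {p..p + real n})" using real_arch_simple[of "x - p"] by (auto simp: algebra_simps)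
  qed auto
  moreover have "(\<lambda>n. emeasure \<rho> {p..p + real n}) \<longlonglongrightarrow> ennreal (exp (- ell c p) - 0)"
    unfolding fin
  proof (intro tendsto_ennrealI tendsto_diff tendsto_const)
    show "(\<lambda>n. exp (- ell c (p + real n))) \<longlonglongrightarrow> 0"
    proof (rule tendsto_sandwich[of "\<lambda>_. 0"])
      show "(\<lambda>n. exp (- real n)) \<longlonglongrightarrow> 0"
        by (intro filterlim_compose[OF exp_at_bot] filterlim_compose[OF filterlim_uminus_at_bot_at_top] filterlim_real_sequentially)
      show "\<forall>\<^sub>F n in sequentially. exp (- ell c (p + real n)) \<le> exp (- real n)"
        using ell_ge(1)[of "p + real n" c for n] assms by (intro always_eventually allI) (smt (verit) exp_le_cancel_iff)
    qed auto
  qed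
  ultimately have "emeasure \<rho> {p..} = ennreal (exp (- ell c p))"
    by (metis LIMSEQ_unique diff_zero)
  then show ?thesis by (simp add: \<rho>_def emeasure_density)
qed

text \<open>The distribution function to be realised forces the conditional probability of
  \<open>\<xi>\<^sub>2 \<le> x\<close> given \<open>1 / \<xi>\<^sub>1 = t\<close> to be \<open>condf t x\<close>.\<close>

definition condf :: "real \<Rightarrow> real \<Rightarrow> real" where
  "condf t x = exp (t - ell (1 / x) t) * slope (1 / x) t"

section \<open>Conditional distribution functions and their quantiles\<close>

lemma condf_nonneg: "0 \<le> condf t x"
  by (simp add: condf_def slope_nonneg)

lemma condf_le_1: "condf t x \<le> 1"
  unfolding condf_def using ell_ge(1)[of t "1 / x"] slope_nonneg slope_le_1 by (intro mult_le_one) auto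

lemma condf_mono:
  assumes "0 < x" "x \<le> y" shows "condf t x \<le> condf t y"
proof -
  have "1 / y \<le> 1 / x" using assms by (simp add: frac_le)
  then show ?thesis unfolding condf_def
    by (intro mult_mono slope_antimono slope_nonneg) (auto intro: ell_mono2)
qed

lemma borel_condf [measurable]: "(\<lambda>t. condf t x) \<in> borel_measurable borel"
  unfolding condf_def by measurable

lemma slope_tendsto:
  assumes "\<And>a. a \<in> space \<sigma> \<Longrightarrow> (\<lambda>n. fst a * of_bool (snd a * cn n \<le> fst a * t)) \<longlonglongrightarrow> fst a * of_bool (snd a * c \<le> fst a * t)"
  shows "(\<lambda>n. slope (cn n) t) \<longlonglongrightarrow> slope c t"
  unfolding slope_def
proof (rule integral_dominated_convergence[where w = "\<lambda>_. 1"])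
  show "AE a in \<sigma>. norm (fst a * of_bool (snd a * cn n \<le> fst a * t)) \<le> 1" for n
    using coord_bounds by (intro AE_I2) (auto simp: of_bool_def)
qed (use assms in \<open>auto intro: borel_measurable_integrable integrable_fst_indicator pred_slope\<close>)

text \<open>\<open>ell\<close> is 1-Lipschitz in its first argument because the second coordinate
  has mean 1.\<close>

lemma ell_tendsto:
  assumes "cn \<longlonglongrightarrow> c" shows "(\<lambda>n. ell (cn n) t) \<longlonglongrightarrow> ell c t"
proof -
  have *: "\<bar>ell d t - ell c t\<bar> \<le> \<bar>d - c\<bar>" for d
  proof -
    have "ell d t - ell c t = (\<integral>a. max (fst a * t) (snd a * d) - max (fst a * t) (snd a * c) \<partial>\<sigma>)"
      unfolding ell_def by (rule Bochner_Integration.integral_diff[symmetric]) auto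
    also have "\<bar>\<dots>\<bar> \<le> (\<integral>a. \<bar>max (fst a * t) (snd a * d) - max (fst a * t) (snd a * c)\<bar> \<partial>\<sigma>)"
      by (rule integral_abs_bound)
    also have "\<dots> \<le> (\<integral>a. snd a * \<bar>d - c\<bar> \<partial>\<sigma>)"
    proof (intro integral_mono integrable_abs Bochner_Integration.integrable_diff integrable_max integrable_mult_left integrable_snd)
      fix a assume "a \<in> space \<sigma>"
      then have "snd a * \<bar>d - c\<bar> = \<bar>snd a * d - snd a * c\<bar>"
        using coord_bounds by (simp add: abs_mult flip: right_diff_distrib)
      then show "\<bar>max (fst a * t) (snd a * d) - max (fst a * t) (snd a * c)\<bar> \<le> snd a * \<bar>d - c\<bar>" by linarith
    qed
    also have "\<dots> = \<bar>d - c\<bar>" by (rule mean_snd_times)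
    finally show ?thesis .
  qed
  have "(\<lambda>n. ell (cn n) t - ell c t) \<longlonglongrightarrow> 0"
  proof (rule Lim_null_comparison)
    show "\<forall>\<^sub>F n in sequentially. norm (ell (cn n) t - ell c t) \<le> \<bar>cn n - c\<bar>"
      using * by (intro always_eventually allI) simp
    show "(\<lambda>n. \<bar>cn n - c\<bar>) \<longlonglongrightarrow> 0"
      using tendsto_rabs_zero[OF LIM_zero[OF assms]] by simp
  qed
  then show ?thesis by (rule LIM_zero_cancel)
qed

text \<open>As x decreases to its limit, 1/x increases, and the non-strict inequality in
  \<open>slope\<close> makes it left-continuous in that argument.\<close>

lemma condf_right_continuous:
  assumes "0 < x"
  shows "(\<lambda>n. condf t (x + 1 / real (Suc n))) \<longlonglongrightarrow> condf t x"
proof -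
  define cn where "cn n = 1 / (x + 1 / real (Suc n))" for n
  have "(\<lambda>n. x + 1 / real (Suc n)) \<longlonglongrightarrow> x + 0" by (intro tendsto_intros LIMSEQ_Suc[OF lim_1_over_n])
  then have cn: "cn \<longlonglongrightarrow> 1 / x" unfolding cn_def using assms by (intro tendsto_divide tendsto_const) auto
  have le: "cn n \<le> 1 / x" for n unfolding cn_def using assms by (intro frac_le) auto
  have "(\<lambda>n. slope (cn n) t) \<longlonglongrightarrow> slope (1 / x) t"
  proof (rule slope_tendsto)
    fix a assume a: "a \<in> space \<sigma>"
    show "(\<lambda>n. fst a * of_bool (snd a * cn n \<le> fst a * t)) \<longlonglongrightarrow> fst a * of_bool (snd a * (1 / x) \<le> fst a * t)"
    proof (cases "snd a * (1 / x) \<le> fst a * t")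
      case True
      have "snd a * cn n \<le> fst a * t" for n
        using mult_left_mono[OF le[of n], of "snd a"] coord_bounds[OF a] True by linarith
      then show ?thesis using True by simp
    next
      case False
      have "(\<lambda>n. snd a * cn n) \<longlonglongrightarrow> snd a * (1 / x)" by (intro tendsto_intros cn)
      then have "\<forall>\<^sub>F n in sequentially. fst a * t < snd a * cn n"
        using False by (intro order_tendstoD(1)) auto
      then have "\<forall>\<^sub>F n in sequentially. fst a * of_bool (snd a * cn n \<le> fst a * t) = 0"
        by eventually_elim simp
      then show ?thesis using False by (simp add: tendsto_eventually)
    qed
  qed
  moreover have "(\<lambda>n. exp (t - ell (cn n) t)) \<longlonglongrightarrow> exp (t - ell (1 / x) t)"
    by (intro tendsto_intros ell_tendsto cn)
  ultimately show ?thesis unfolding condf_def cn_def[symmetric] by (rule tendsto_mult[rotated])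
qed

text \<open>Excludes conditional mass at infinity. In the limit \<open>slope 0 t\<close> is 1 by the
  first mean; atoms with a1 > 0 satisfy the inequality eventually since t > 0.\<close>

lemma condf_at_top:
  assumes "0 < t"
  shows "(\<lambda>n. condf t (real (Suc n))) \<longlonglongrightarrow> 1"
proof -
  have cn: "(\<lambda>n. 1 / real (Suc n)) \<longlonglongrightarrow> 0" by (rule LIMSEQ_Suc[OF lim_1_over_n])
  have "(\<lambda>n. slope (1 / real (Suc n)) t) \<longlonglongrightarrow> slope 0 t"
  proof (rule slope_tendsto)
    fix a assume a: "a \<in> space \<sigma>"
    show "(\<lambda>n. fst a * of_bool (snd a * (1 / real (Suc n)) \<le> fst a * t)) \<longlonglongrightarrow> fst a * of_bool (snd a * 0 \<le> fst a * t)"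
    proof (cases "fst a = 0")
      case False
      then have pos: "0 < fst a * t" using assms coord_bounds[OF a] by auto
      have "(\<lambda>n. snd a * (1 / real (Suc n))) \<longlonglongrightarrow> snd a * 0" by (intro tendsto_mult tendsto_const cn)
      then have "\<forall>\<^sub>F n in sequentially. snd a * (1 / real (Suc n)) < fst a * t"
        using pos by (intro order_tendstoD(2)) auto
      then have "\<forall>\<^sub>F n in sequentially. fst a * of_bool (snd a * (1 / real (Suc n)) \<le> fst a * t) = fst a"
        by eventually_elim simp
      then show ?thesis using pos by (simp add: tendsto_eventually)
    qed simp
  qed
  moreover have "slope 0 t = 1"
    unfolding slope_def mean_fst[symmetric]
    by (intro Bochner_Integration.integral_cong) (use coord_bounds assms in auto)
  moreover have "ell 0 t = t" using ell_le[of 0 t] ell_ge(1)[of t 0] assms by simp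
  moreover have "(\<lambda>n. exp (t - ell (1 / real (Suc n)) t)) \<longlonglongrightarrow> exp (t - ell 0 t)"
    by (intro tendsto_intros ell_tendsto cn)
  ultimately have "(\<lambda>n. exp (t - ell (1 / real (Suc n)) t) * slope (1 / real (Suc n)) t) \<longlonglongrightarrow> 1"
    using tendsto_mult by force
  then show ?thesis by (simp add: condf_def)
qed

text \<open>Generalised inverse of \<open>condf t\<close> on the positive axis. The value 0
  elsewhere only makes the function total; those arguments form a null set for the law used
  below.\<close>

definition quantile :: "real \<times> real \<Rightarrow> real" where
  "quantile p = (if 0 < fst p \<and> 0 < snd p \<and> snd p < 1
     then Inf {x. 0 < x \<and> snd p \<le> condf (fst p) x} else 0)"

text \<open>Right continuity of \<open>condf\<close> lets the inequality survive at the infimum; the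
  limit 1 at infinity makes the set nonempty.\<close>

lemma quantile_le_iff:
  assumes "0 < t" "0 < u" "u < 1" "0 < x"
  shows "quantile (t, u) \<le> x \<longleftrightarrow> u \<le> condf t x"
proof -
  define Q where "Q = {x. 0 < x \<and> u \<le> condf t x}"
  have q: "quantile (t, u) = Inf Q" using assms by (simp add: quantile_def Q_def)
  have bdd: "bdd_below Q" by (auto simp: Q_def intro!: bdd_belowI[of _ 0] less_imp_le)
  have "\<forall>\<^sub>F n in sequentially. u < condf t (real (Suc n))"
    using condf_at_top[OF assms(1)] assms(3) by (rule order_tendstoD(1))
  then obtain n where "u < condf t (real (Suc n))" by (auto simp: eventually_sequentially)
  then have "real (Suc n) \<in> Q" by (simp add: Q_def)
  then have ne: "Q \<noteq> {}" by blast
  show ?thesis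
  proof
    assume "u \<le> condf t x"
    then have "x \<in> Q" using assms by (simp add: Q_def)
    then show "quantile (t, u) \<le> x" unfolding q by (rule cInf_lower[OF _ bdd])
  next
    assume le: "quantile (t, u) \<le> x"
    have "u \<le> condf t (x + 1 / real (Suc n))" for n
    proof -
      have "Inf Q < x + 1 / real (Suc n)" using le q by (simp add: add_pos_pos less_add_same_cancel1 le_less_trans)
      then obtain y where y: "y \<in> Q" "y < x + 1 / real (Suc n)" using cInf_lessD[OF ne] by blast
      then show ?thesis using condf_mono[of y "x + 1 / real (Suc n)" t] by (auto simp: Q_def)
    qed
    then show "u \<le> condf t x"
      by (intro LIMSEQ_le_const[OF condf_right_continuous[OF assms(4)]]) auto
  qed
qed

lemma quantile_nonneg: "0 \<le> quantile p"
proof (cases "0 < fst p \<and> 0 < snd p \<and> snd p < 1")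
  case True
  show ?thesis
  proof (rule ccontr)
    assume neg: "\<not> ?thesis"
    define Q where "Q = {x. 0 < x \<and> snd p \<le> condf (fst p) x}"
    have q: "quantile p = Inf Q" using True by (simp add: quantile_def Q_def)
    have "\<forall>\<^sub>F n in sequentially. snd p < condf (fst p) (real (Suc n))"
      using condf_at_top True by (intro order_tendstoD(1)) auto
    then obtain n where "snd p < condf (fst p) (real (Suc n))" by (auto simp: eventually_sequentially)
    then have "real (Suc n) \<in> Q" by (simp add: Q_def)
    then have "Q \<noteq> {}" by blast
    then have "0 \<le> Inf Q" by (rule cInf_greatest) (simp add: Q_def)
    then show False using neg q by simp
  qed
next
  case False
  then have "quantile p = 0" by (simp only: quantile_def if_False)
  then show ?thesis by simp
qed

lemma borel_quantile [measurable]: "quantile \<in> borel_measurable (borel \<Otimes>\<^sub>M borel)"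
proof -
  have pos: "{p. quantile p \<le> x} \<in> sets (borel \<Otimes>\<^sub>M borel)" if "0 < x" for x
  proof -
    have "{p. quantile p \<le> x} = {p \<in> space (borel \<Otimes>\<^sub>M borel). 0 < fst p \<and> 0 < snd p \<and> snd p < 1 \<longrightarrow> snd p \<le> condf (fst p) x}"
    proof (intro Collect_cong)
      fix p :: "real \<times> real"
      show "quantile p \<le> x \<longleftrightarrow> p \<in> space (borel \<Otimes>\<^sub>M borel) \<and> (0 < fst p \<and> 0 < snd p \<and> snd p < 1 \<longrightarrow> snd p \<le> condf (fst p) x)"
      proof (cases "0 < fst p \<and> 0 < snd p \<and> snd p < 1")
        case True
        then show ?thesis using quantile_le_iff[of "fst p" "snd p" x] that by (simp add: space_pair_measure)
      next
        case False
        then have "quantile p = 0" by (simp only: quantile_def if_False)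
        then show ?thesis using that False by (auto simp: space_pair_measure)
      qed
    qed
    also have "\<dots> \<in> sets (borel \<Otimes>\<^sub>M borel)" by measurable
    finally show ?thesis .
  qed
  show ?thesis
    unfolding borel_measurable_iff_le
  proof
    fix x :: real
    have "{p \<in> space (borel \<Otimes>\<^sub>M borel). quantile p \<le> x} = {p. quantile p \<le> x}" by (simp add: space_pair_measure)
    moreover have "{p. quantile p \<le> x} \<in> sets (borel \<Otimes>\<^sub>M borel)"
    proof -
      \<comment> \<open>The equivalence with \<open>condf\<close> covers only positive levels; level
        0 is their countable intersection, and negative levels are empty.\<close>
      consider "0 < x" | "x = 0" | "x < 0" by linarith
      then show ?thesis
      proof cases
        case 2
        have "{p. quantile p \<le> x} = (\<Inter>n. {p. quantile p \<le> 1 / real (Suc n)})"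
        proof (intro equalityI subsetI)
          fix p assume p: "p \<in> (\<Inter>n. {p. quantile p \<le> 1 / real (Suc n)})"
          have "quantile p \<le> 0"
            by (rule LIMSEQ_le_const[OF LIMSEQ_Suc[OF lim_1_over_n]]) (use p in auto)
          then show "p \<in> {p. quantile p \<le> x}" using 2 by simp
        qed (use 2 in \<open>auto intro: order_trans[of _ 0]\<close>)
        also have "\<dots> \<in> sets (borel \<Otimes>\<^sub>M borel)" by (intro sets.countable_INT) (auto intro!: pos)
        finally show ?thesis .
      next
        case 3
        then have "{p. quantile p \<le> x} = {}" using quantile_nonneg by (auto simp: not_le intro: less_le_trans)
        then show ?thesis by (simp only: sets.empty_sets)
      qed (rule pos)
    qed
    ultimately show "{p \<in> space (borel \<Otimes>\<^sub>M borel). quantile p \<le> x} \<in> sets (borel \<Otimes>\<^sub>M borel)" by simp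
  qed
qed

text \<open>The reciprocal of a unit Frechet variable is standard exponential. An independent
  uniform variable, put through the conditional quantile, supplies the second coordinate.\<close>

definition joint_law :: "(real \<times> real) measure" where
  "joint_law = distr (density lborel (exponential_density 1) \<Otimes>\<^sub>M uniform_measure lborel {0..1}) borel
     (\<lambda>p. (1 / fst p, quantile p))"

lemma joint_law_measurable:
  "(\<lambda>p. (1 / fst p, quantile p)) \<in>
     density lborel (exponential_density 1) \<Otimes>\<^sub>M uniform_measure lborel {0..1} \<rightarrow>\<^sub>M borel"
proof -
  have "(\<lambda>p. (1 / fst p, quantile p)) \<in> borel \<Otimes>\<^sub>M borel \<rightarrow>\<^sub>M borel \<Otimes>\<^sub>M borel" by measurable
  moreover have "sets (density lborel (exponential_density 1) \<Otimes>\<^sub>M uniform_measure lborel {0..1}) = sets (borel \<Otimes>\<^sub>M borel)"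
    by (intro sets_pair_measure_cong) auto
  ultimately show ?thesis unfolding borel_prod by (subst measurable_cong_sets[OF _ refl]) 
qed

lemma prob_space_joint_law: "prob_space joint_law"
proof -
  interpret E: prob_space "density lborel (exponential_density 1)" by (rule prob_space_exponential_density) simp
  interpret U: prob_space "uniform_measure lborel {0..1::real}" by (rule prob_space_uniform_measure) auto
  interpret P: pair_prob_space "density lborel (exponential_density 1)" "uniform_measure lborel {0..1::real}" ..
  show ?thesis unfolding joint_law_def by (rule P.prob_space_distr[OF joint_law_measurable])
qed

text \<open>By Fubini the fibre over \<open>t\<close> is essentially the set of \<open>u\<close> up
  to \<open>condf t x2\<close>, provided t \<ge> 1/x1. The exponential density cancels the factor
  exp t in \<open>condf\<close>, and what remains integrates to the exponent formula.\<close>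

lemma emeasure_joint_law:
  assumes x: "0 < x1" "0 < x2"
  shows "emeasure joint_law {y. fst y \<le> x1 \<and> snd y \<le> x2} = ennreal (exp (- ell (1 / x2) (1 / x1)))"
proof -
  let ?E = "density lborel (exponential_density 1)" and ?U = "uniform_measure lborel {0..1::real}"
  interpret E: prob_space ?E by (rule prob_space_exponential_density) simp
  interpret U: prob_space ?U by (rule prob_space_uniform_measure) auto
  define A where "A = {y :: real \<times> real. fst y \<le> x1 \<and> snd y \<le> x2}"
  define B where "B = (\<lambda>p. (1 / fst p, quantile p)) -` A \<inter> space (?E \<Otimes>\<^sub>M ?U)"
  have A: "A \<in> sets borel"
    unfolding A_def by (intro borel_closed closed_Collect_conj closed_Collect_le continuous_intros)
  have B: "B \<in> sets (?E \<Otimes>\<^sub>M ?U)" unfolding B_def by (rule measurable_sets[OF joint_law_measurable A])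
  have sec: "emeasure ?U (Pair t -` B) = indicator {1 / x1..} t * ennreal (condf t x2)" if "0 < t" for t
  proof -
    have sB: "Pair t -` B \<in> sets ?U" using B by (rule sets_Pair1)
    have "1 / t \<le> x1 \<longleftrightarrow> 1 / x1 \<le> t" using that x by (simp add: field_simps)
    then have mem: "u \<in> Pair t -` B \<longleftrightarrow> 1 / x1 \<le> t \<and> u \<le> condf t x2" if "0 < u" "u < 1" for u
      using quantile_le_iff[OF \<open>0 < t\<close> that x(2)] by (simp add: B_def A_def space_pair_measure)
    have "emeasure ?U (Pair t -` B) = emeasure lborel ({0..1} \<inter> Pair t -` B)"
      using sB by (simp add: divide_ennreal_def)
    also have "\<dots> = emeasure lborel (if 1 / x1 \<le> t then {0..condf t x2} else {})"
    proof (rule emeasure_eq_AE)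
      \<comment> \<open>At u = 0 and u = 1 \<open>quantile\<close> has its default value.\<close>
      have "AE u in lborel. u \<noteq> (0::real)" "AE u in lborel. u \<noteq> (1::real)" by (rule AE_lborel_singleton)+
      then show "AE u in lborel. u \<in> {0..1} \<inter> Pair t -` B \<longleftrightarrow> u \<in> (if 1 / x1 \<le> t then {0..condf t x2} else {})"
      proof eventually_elim
        case (elim u)
        show ?case
        proof (cases "0 < u \<and> u < 1")
          case True
          then show ?thesis using mem by auto
        next
          case False
          then show ?thesis using elim condf_le_1[of t x2] by (auto split: if_splits)
        qed
      qed
    qed (use sB in auto)
    also have "\<dots> = indicator {1 / x1..} t * ennreal (condf t x2)"
      using condf_nonneg by auto
    finally show ?thesis .
  qed
  have "emeasure joint_law A = emeasure (?E \<Otimes>\<^sub>M ?U) B"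
    unfolding joint_law_def B_def by (rule emeasure_distr[OF joint_law_measurable A])
  also have "\<dots> = (\<integral>\<^sup>+t. emeasure ?U (Pair t -` B) \<partial>?E)"
    by (rule U.emeasure_pair_measure_alt[OF B])
  also have "\<dots> = (\<integral>\<^sup>+t. ennreal (exponential_density 1 t) * emeasure ?U (Pair t -` B) \<partial>lborel)"
    by (rule nn_integral_density) (use U.measurable_emeasure_Pair[OF B] in auto)
  also have "\<dots> = (\<integral>\<^sup>+t. ennreal (exp (- ell (1 / x2) t) * slope (1 / x2) t) * indicator {1 / x1..} t \<partial>lborel)"
  proof (rule nn_integral_cong_AE)
    \<comment> \<open>At t = 0 the two integrands differ: 1/0 = 0 makes the fibre full, while the
      indicator vanishes.\<close>
    have "AE t in lborel. t \<noteq> (0::real)" by (rule AE_lborel_singleton)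
    then show "AE t in lborel. ennreal (exponential_density 1 t) * emeasure ?U (Pair t -` B) =
       ennreal (exp (- ell (1 / x2) t) * slope (1 / x2) t) * indicator {1 / x1..} t"
    proof eventually_elim
      case (elim t)
      show ?case
      proof (cases "0 < t")
        case True
        have "exp (- t) * condf t x2 = exp (- ell (1 / x2) t) * slope (1 / x2) t"
          by (simp add: condf_def mult.assoc[symmetric] flip: exp_add)
        then show ?thesis using True condf_nonneg[of t x2]
          by (auto simp: sec exponential_density_def indicator_def ennreal_mult'[symmetric])
      next
        case False
        moreover have "\<not> 1 / x1 \<le> t" using x False by (meson divide_pos_pos le_less_trans not_less zero_less_one order.strict_trans2)
        ultimately show ?thesis using elim by (simp add: exponential_density_def)
      qed
    qed
  qed
  also have "\<dots> = ennreal (exp (- ell (1 / x2) (1 / x1)))" using x by (intro nn_integral_exp_ell) simp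
  finally show ?thesis by (simp add: A_def)
qed

lemma cdf2_joint_law:
  assumes "0 < x1" "0 < x2"
  shows "cdf2 joint_law (x1, x2) = exp (- (\<integral>a. max (fst a / x1) (snd a / x2) \<partial>\<sigma>))"
  unfolding cdf2_def measure_def using emeasure_joint_law[OF assms] by (simp add: ell_def)

lemma sets_joint_law [simp]: "sets joint_law = sets borel" and space_joint_law [simp]: "space joint_law = UNIV"
  by (simp_all add: joint_law_def)

lemma ex_simple_max_stable: "\<exists>\<mu>. simple_max_stable \<mu> \<and> is_spectral_measure \<mu> \<sigma>"
proof (intro exI conjI)
  interpret J: prob_space joint_law by (rule prob_space_joint_law)
  have setI: "{y :: real \<times> real. fst y \<le> x1 \<and> snd y \<le> x2} \<in> sets joint_law" for x1 x2
    unfolding sets_joint_law by (intro borel_closed closed_Collect_conj closed_Collect_le continuous_intros)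
  show "is_spectral_measure joint_law \<sigma>"
    unfolding is_spectral_measure_def
    using finite_measure_axioms sets_eq mean_fst mean_snd cdf2_joint_law by auto
  have cdf: "cdf2 joint_law (x1, x2) = exp (- ell (1 / x2) (1 / x1))" if "0 < x1" "0 < x2" for x1 x2
    using cdf2_joint_law[OF that] by (simp add: ell_def)
  have lim: "(\<lambda>n. 1 / real (Suc n)) \<longlonglongrightarrow> 0" by (rule LIMSEQ_Suc[OF lim_1_over_n])
  have m1: "measure joint_law {y. fst y \<le> t} = exp (- 1 / t)" if t: "0 < t" for t
  proof -
    define A where "A n = {y :: real \<times> real. fst y \<le> t \<and> snd y \<le> real (Suc n)}" for n
    have U: "(\<Union>n. A n) = {y. fst y \<le> t}"
    proof (intro equalityI subsetI)
      fix y :: "real \<times> real" assume y: "y \<in> {y. fst y \<le> t}"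
      obtain n where "snd y \<le> real n" using real_arch_simple by blast
      then show "y \<in> (\<Union>n. A n)" using y by (auto simp: A_def intro!: exI[of _ n])
    qed (auto simp: A_def)
    have "(\<lambda>n. measure joint_law (A n)) \<longlonglongrightarrow> measure joint_law (\<Union>n. A n)"
      by (rule J.finite_Lim_measure_incseq) (use setI in \<open>auto simp: A_def incseq_def\<close>)
    moreover have "measure joint_law (A n) = exp (- ell (1 / real (Suc n)) (1 / t))" for n
      using cdf[OF t, of "real (Suc n)"] by (simp add: cdf2_def A_def)
    moreover have "(\<lambda>n. exp (- ell (1 / real (Suc n)) (1 / t))) \<longlonglongrightarrow> exp (- ell 0 (1 / t))"
      by (intro tendsto_intros ell_tendsto lim)
    moreover have "ell 0 (1 / t) = 1 / t" using ell_le[of 0 "1/t"] ell_ge(1)[of "1/t" 0] t by simp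
    ultimately show ?thesis using LIMSEQ_unique U by auto
  qed
  have m2: "measure joint_law {y. snd y \<le> t} = exp (- 1 / t)" if t: "0 < t" for t
  proof -
    define A where "A n = {y :: real \<times> real. fst y \<le> real (Suc n) \<and> snd y \<le> t}" for n
    have U: "(\<Union>n. A n) = {y. snd y \<le> t}"
    proof (intro equalityI subsetI)
      fix y :: "real \<times> real" assume y: "y \<in> {y. snd y \<le> t}"
      obtain n where "fst y \<le> real n" using real_arch_simple by blast
      then show "y \<in> (\<Union>n. A n)" using y by (auto simp: A_def intro!: exI[of _ n])
    qed (auto simp: A_def)
    have "(\<lambda>n. measure joint_law (A n)) \<longlonglongrightarrow> measure joint_law (\<Union>n. A n)"
      by (rule J.finite_Lim_measure_incseq) (use setI in \<open>auto simp: A_def incseq_def\<close>)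
    moreover have "measure joint_law (A n) = exp (- ell (1 / t) (1 / real (Suc n)))" for n
      using cdf[OF _ t, of "real (Suc n)"] by (simp add: cdf2_def A_def)
    moreover have "(\<lambda>n. exp (- ell (1 / t) (1 / real (Suc n)))) \<longlonglongrightarrow> exp (- (1 / t))"
    \<comment> \<open>Here the second argument of \<open>ell\<close> tends to 0, which
      \<open>ell_tendsto\<close> does not cover; the bounds 1/t and 1/(n + 1) + 1/t enclose
      it.\<close>
    proof (intro tendsto_intros, rule tendsto_sandwich[of "\<lambda>_. 1/t"])
      show "(\<lambda>n. 1 / real (Suc n) + 1 / t) \<longlonglongrightarrow> 1 / t" using tendsto_add[OF lim tendsto_const[of "1/t"]] by simp
    qed (use t in \<open>auto intro!: always_eventually ell_le ell_ge\<close>)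
    ultimately show ?thesis using LIMSEQ_unique U by auto
  qed
  \<comment> \<open>Max-stability is required at every point of the plane. Off the open quadrant the
    distribution function vanishes, since the marginals exp(-1/t) tend to 0 as t decreases to
    0.\<close>
  have tail: "cdf2 joint_law x = 0" if "\<not> (0 < fst x \<and> 0 < snd x)" for x
  proof -
    have le: "cdf2 joint_law x \<le> exp (- real (Suc n))" for n
    proof -
      have pos: "0 < 1 / real (Suc n)" by simp
      consider "fst x \<le> 0" | "snd x \<le> 0" using \<open>\<not> (0 < fst x \<and> 0 < snd x)\<close> by linarith
      then show ?thesis
      proof cases
        case 1
        have "{y :: real \<times> real. fst y \<le> 1 / real (Suc n)} \<in> sets joint_law"
          unfolding sets_joint_law by (intro borel_closed closed_Collect_le continuous_intros)
        then have "cdf2 joint_law x \<le> measure joint_law {y. fst y \<le> 1 / real (Suc n)}"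
          unfolding cdf2_def using order_trans[OF 1 less_imp_le[OF pos]] by (intro J.finite_measure_mono) auto
        then show ?thesis unfolding m1[OF pos] by simp
      next
        case 2
        have "{y :: real \<times> real. snd y \<le> 1 / real (Suc n)} \<in> sets joint_law"
          unfolding sets_joint_law by (intro borel_closed closed_Collect_le continuous_intros)
        then have "cdf2 joint_law x \<le> measure joint_law {y. snd y \<le> 1 / real (Suc n)}"
          unfolding cdf2_def using order_trans[OF 2 less_imp_le[OF pos]] by (intro J.finite_measure_mono) auto
        then show ?thesis unfolding m2[OF pos] by simp
      qed
    qed
    have "(\<lambda>n. exp (- real (Suc n))) \<longlonglongrightarrow> 0"
      by (intro LIMSEQ_Suc filterlim_compose[OF exp_at_bot] filterlim_compose[OF filterlim_uminus_at_bot_at_top] filterlim_real_sequentially)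
    then have "cdf2 joint_law x \<le> 0" by (rule LIMSEQ_le_const) (use le in auto)
    then show ?thesis by (simp add: cdf2_def measure_le_0_iff)
  qed
  have stable: "cdf2 joint_law (real n *\<^sub>R x) ^ n = cdf2 joint_law x" if n: "1 \<le> n" for n x
  proof (cases "0 < fst x \<and> 0 < snd x")
    case True
    define V where "V = (\<integral>a. max (fst a / fst x) (snd a / snd x) \<partial>\<sigma>)"
    have n0: "0 < real n" using n by simp
    \<comment> \<open>The exponent is homogeneous of degree -1, so the n-th power undoes the scaling
      by n.\<close>
    have "(\<integral>a. max (fst a / (real n * fst x)) (snd a / (real n * snd x)) \<partial>\<sigma>) = (\<integral>a. max (fst a / fst x) (snd a / snd x) / real n \<partial>\<sigma>)"
      using n0 by (intro Bochner_Integration.integral_cong) (auto simp: max_divide_distrib_right field_simps)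
    then have V: "(\<integral>a. max (fst a / (real n * fst x)) (snd a / (real n * snd x)) \<partial>\<sigma>) = V / real n"
      by (simp add: V_def)
    have "cdf2 joint_law (real n *\<^sub>R x) = exp (- (V / real n))"
      unfolding V[symmetric] using cdf2_joint_law[of "real n * fst x" "real n * snd x"] True n0
      by (simp add: scaleR_prod_def)
    moreover have "exp (- (V / real n)) ^ n = exp (- V)"
      using n0 by (simp flip: exp_of_nat_mult)
    moreover have "cdf2 joint_law x = exp (- V)"
      using cdf2_joint_law[of "fst x" "snd x"] True by (simp add: V_def)
    ultimately show ?thesis by simp
  next
    case False
    then have "\<not> (0 < fst (real n *\<^sub>R x) \<and> 0 < snd (real n *\<^sub>R x))"
      using n by (auto simp: zero_less_mult_iff)
    then show ?thesis using False n by (simp add: tail)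
  qed
  show "simple_max_stable joint_law"
    unfolding simple_max_stable_def using J.prob_space_axioms m1 m2 stable by auto
qed

end

section \<open>Dependency sets\<close>

lemma flipset_eq_image: "flipset K = prod.swap ` K"
  by (force simp: flipset_def image_iff)

lemma support_fun_flipset: "support_fun (flipset K) (x, y) = support_fun K (y, x)"
  unfolding support_fun_def flipset_eq_image image_image
  by (intro arg_cong[of _ _ Sup] image_cong) (auto simp: inner_prod_def)

lemma inner_le_support_fun:
  assumes "compact K" "y \<in> K" shows "inner y x \<le> support_fun K x"
  unfolding support_fun_def
proof (rule cSUP_upper[OF assms(2)])
  have "compact ((\<lambda>y. inner y x) ` K)"
    by (intro compact_continuous_image continuous_intros assms)
  then show "bdd_above ((\<lambda>y. inner y x) ` K)" by (intro bounded_imp_bdd_above compact_imp_bounded)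
qed

lemma support_fun_le:
  assumes "K \<noteq> {}" "\<And>y. y \<in> K \<Longrightarrow> inner y x \<le> c" shows "support_fun K x \<le> c"
  unfolding support_fun_def by (rule cSUP_least) (use assms in auto)

definition sandwiched :: "(real \<times> real) set \<Rightarrow> bool" where
  "sandwiched K \<longleftrightarrow> compact K \<and> convex K \<and> convex hull {(0,0), (1,0), (0,1)} \<subseteq> K \<and> K \<subseteq> {0..1} \<times> {0..1}"

lemma convex_hull_corners_subset_iff:
  "convex K \<Longrightarrow> convex hull {(0,0), (1,0), (0,1)} \<subseteq> K \<longleftrightarrow> (0,0) \<in> K \<and> (1,0) \<in> K \<and> (0,1::real) \<in> (K :: (real \<times> real) set)"
  by (subst subset_hull) auto

text \<open>Provides the one candidate for \<sigma> used in both directions. Reflecting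
  \<open>K\<close> swaps the arguments of its support function, which undoes the swap of coordinates
  between a segment and its normal.\<close>

lemma ex_normal_measure:
  assumes "sandwiched K"
  shows "\<exists>\<tau>. angular_measure \<tau> \<and>
    (\<forall>A\<in>sets \<tau>. emeasure \<tau> A = length_measure (flipset K) A) \<and>
    (\<forall>s\<ge>0. \<forall>t\<ge>0. support_fun K (s, t) = (\<integral>a. max (fst a * s) (snd a * t) \<partial>\<tau>))"
proof -
  have K: "compact K" "convex K" "K \<subseteq> {0..1} \<times> {0..1}" "(1,0) \<in> K" "(0,1) \<in> K"
    using assms convex_hull_corners_subset_iff[of K] by (auto simp: sandwiched_def)
  have lin: "linear (prod.swap :: real \<times> real \<Rightarrow> real \<times> real)"
    by (rule linearI) auto
  have "\<exists>g G. body_arc g G (flipset K)"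
  proof (rule ex_body_arc)
    show "compact (flipset K)" unfolding flipset_eq_image
      unfolding prod.swap_def by (intro compact_continuous_image continuous_intros K)
    show "convex (flipset K)" unfolding flipset_eq_image by (rule convex_linear_image[OF lin K(2)])
  qed (use K in \<open>auto simp: flipset_def\<close>)
  then obtain g G where "body_arc g G (flipset K)" by blast
  then interpret body_arc g G "flipset K" .
  have "angular_measure normal_measure"
    unfolding angular_measure_def angular_measure_axioms_def
    using finite_normal_measure sets_normal_measure by blast
  moreover have "emeasure normal_measure A = length_measure (flipset K) A" if "A \<in> sets normal_measure" for A
    using length_measure_eq[of A] that by (simp add: sets_normal_measure)
  moreover have "support_fun K (s, t) = (\<integral>a. max (fst a * s) (snd a * t) \<partial>normal_measure)" if "0 \<le> s" "0 \<le> t" for s t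
    using support_fun_eq[OF that(2,1)] by (simp add: support_fun_flipset)
  ultimately show ?thesis by blast
qed

text \<open>The points \<open>0\<close>, \<open>e\<^sub>1\<close>, \<open>e\<^sub>2\<close> bound the support function below by the one of \<open>[0,1]\<^sup>2\<close> in the
  directions outside the first quadrant, so no such direction separates a point of the square from \<open>K\<close>.\<close>

lemma sandwiched_maximal:
  assumes "sandwiched K" and L: "compact L" "L \<subseteq> orthant"
    and eq: "\<And>x. x \<in> orthant \<Longrightarrow> support_fun L x = support_fun K x"
  shows "L \<subseteq> K"
proof
  fix y assume y: "y \<in> L"
  have K: "compact K" "convex K" "K \<subseteq> {0..1} \<times> {0..1}" "(0,0) \<in> K" "(1,0) \<in> K" "(0,1) \<in> K"
    using assms convex_hull_corners_subset_iff[of K] by (auto simp: sandwiched_def)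
  have ne: "K \<noteq> {}" using K by auto
  have le: "inner y x \<le> support_fun K x" if "x \<in> orthant" for x
    using inner_le_support_fun[OF L(1) y, of x] eq[OF that] by simp
  have sK: "support_fun K (1, 0) \<le> 1" "support_fun K (0, 1) \<le> 1"
    using K(3) by (intro support_fun_le[OF ne]; auto)+
  have y01: "0 \<le> fst y" "fst y \<le> 1" "0 \<le> snd y" "snd y \<le> 1"
    using le[of "(1,0)"] le[of "(0,1)"] sK y L(2) by (auto simp: orthant_def inner_prod_def)
  show "y \<in> K"
  proof (rule ccontr)
    assume "y \<notin> K"
    then obtain a b where ab: "inner a y < b" "\<forall>x\<in>K. b < inner a x"
      using separating_hyperplane_closed_point[OF K(2) compact_imp_closed[OF K(1)]] by blast
    obtain a1 a2 where a: "a = (a1, a2)" by (cases a)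
    \<comment> \<open>The separating functional at the three corners of the triangle.\<close>
    have c: "b < 0" "b < a1" "b < a2" using ab(2) K(4-6) by (auto simp: a)
    have ay: "a1 * fst y + a2 * snd y < b" using ab(1) by (simp add: a inner_prod_def)
    consider "a1 \<le> 0" "a2 \<le> 0" | "0 < a1" "0 < a2" | "0 < a1" "a2 \<le> 0" | "a1 \<le> 0" "0 < a2" by linarith
    then show False
    proof cases
      case 1
      then have "inner y (- a) \<le> support_fun K (- a)" by (intro le) (simp add: a orthant_def)
      also have "\<dots> \<le> - b" using ab(2) ne by (intro support_fun_le) (auto simp: inner_commute intro: less_imp_le)
      finally show False using ab(1) by (simp add: inner_commute)
    next
      case 2
      then have "0 \<le> a1 * fst y + a2 * snd y" using y01 by simp
      then show False using ay c by simp
    next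
      case 3
      have "0 \<le> a1 * fst y" "a2 * 1 \<le> a2 * snd y"
        using 3 y01 mult_left_mono_neg[OF y01(4) 3(2)] by auto
      then show False using ay c by simp
    next
      case 4
      have "0 \<le> a2 * snd y" "a1 * 1 \<le> a1 * fst y"
        using 4 y01 mult_left_mono_neg[OF y01(2) 4(1)] by auto
      then show False using ay c by simp
    qed
  qed
qed

lemma dependency_set_sandwiched:
  assumes "angular_measure \<sigma>" and mean: "(\<integral>a. fst a \<partial>\<sigma>) = 1" "(\<integral>a. snd a \<partial>\<sigma>) = 1"
    and dep: "is_dependency_set \<sigma> K"
  shows "sandwiched K"
proof -
  interpret spectral_angular \<sigma>
    unfolding spectral_angular_def spectral_angular_axioms_def using assms by blast
  have K: "compact K" "convex K" "K \<noteq> {}" "K \<subseteq> orthant"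
    and sup: "\<And>x. x \<in> orthant \<Longrightarrow> support_fun K x = (\<integral>a. max (fst a * fst x) (snd a * snd x) \<partial>\<sigma>)"
    and maximal: "\<And>L. compact L \<Longrightarrow> convex L \<Longrightarrow> L \<noteq> {} \<Longrightarrow> L \<subseteq> orthant \<Longrightarrow>
      (\<And>x. x \<in> orthant \<Longrightarrow> support_fun L x = support_fun K x) \<Longrightarrow> L \<subseteq> K"
    using dep unfolding is_dependency_set_def by blast+
  have sup_ell: "support_fun K x = ell (snd x) (fst x)" if "x \<in> orthant" for x
    using sup[OF that] by (simp add: ell_def)
  have e: "support_fun K (1, 0) = 1" "support_fun K (0, 1) = 1"
    using sup[of "(1,0)"] sup[of "(0,1)"] integral_fst_eq_max integral_snd_eq_max mean by (auto simp: orthant_def)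
  define L where "L = {y \<in> orthant. \<forall>x\<in>orthant. inner y x \<le> support_fun K x}"
  have KL: "K \<subseteq> L" using K inner_le_support_fun[OF K(1)] by (auto simp: L_def)
  then have Lne: "L \<noteq> {}" using K(3) by blast
  have L01: "L \<subseteq> {0..1} \<times> {0..1}"
  proof
    fix y assume y: "y \<in> L"
    then have "inner y (1, 0) \<le> support_fun K (1, 0)" "inner y (0, 1) \<le> support_fun K (0, 1)"
      by (auto simp: L_def orthant_def)
    then show "y \<in> {0..1} \<times> {0..1}" using y e by (cases y) (auto simp: L_def orthant_def)
  qed
  have orthant: "orthant = {0..} \<times> {0..}" by (auto simp: orthant_def)
  have orth: "closed orthant" "convex orthant"
    unfolding orthant by (intro closed_Times convex_Times; simp)+
  have Leq: "L = orthant \<inter> (\<Inter>x\<in>orthant. {y. inner x y \<le> support_fun K x})"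
    by (rule set_eqI) (simp only: L_def mem_Collect_eq Int_iff INT_iff inner_commute)
  have "closed L" "convex L" unfolding Leq
    by (intro closed_Int closed_INT convex_Int convex_INT orth ballI closed_halfspace_le convex_halfspace_le)+
  moreover have "bounded L" by (rule bounded_subset[OF _ L01]) (intro bounded_Times bounded_closed_interval)
  ultimately have "compact L" "convex L" by (simp_all only: compact_eq_bounded_closed simp_thms)
  have LK: "L \<subseteq> K"
  proof (rule maximal[OF \<open>compact L\<close> \<open>convex L\<close> Lne])
    show "L \<subseteq> orthant" unfolding L_def by (rule Collect_restrict)
  next
    fix x assume x: "x \<in> orthant"
    show "support_fun L x = support_fun K x"
    proof (rule antisym)
      show "support_fun L x \<le> support_fun K x"
        using x by (intro support_fun_le[OF Lne]) (simp add: L_def)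
      show "support_fun K x \<le> support_fun L x"
        using KL by (intro support_fun_le[OF K(3)] inner_le_support_fun[OF \<open>compact L\<close>]) blast
    qed
  qed
  \<comment> \<open>Since max(a1 x1, a2 x2) is at least either term, integration with means 1 bounds
    the support function below by x1 and by x2.\<close>
  have corner: "inner y x \<le> support_fun K x" if "y \<in> {(0,0), (1,0), (0,1)}" "x \<in> orthant" for x y
    using that sup_ell[OF that(2)] ell_ge(1)[of "fst x" "snd x"] ell_ge(2)[of "snd x" "fst x"]
    by (auto simp: orthant_def inner_prod_def)
  have "{(0,0), (1,0), (0,1)} \<subseteq> L"
  proof
    fix y :: "real \<times> real" assume y: "y \<in> {(0,0), (1,0), (0,1)}"
    then have "y \<in> orthant" by (auto simp: orthant_def)
    then show "y \<in> L" unfolding L_def using corner[OF y] by blast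
  qed
  then have "convex hull {(0,0), (1,0), (0,1)} \<subseteq> K"
    using LK by (intro hull_minimal K(2)) (rule subset_trans)
  then show ?thesis
    unfolding sandwiched_def using K(1,2) subset_trans[OF KL L01] by blast
qed

theorem theorem4p2:
  fixes \<sigma> :: "(real \<times> real) measure" and K :: "(real \<times> real) set"
  assumes "finite_measure \<sigma>"
    and "sets \<sigma> = sets (restrict_space borel S1p)"
  shows "spectral_measure_with_dependency_set \<sigma> K \<longleftrightarrow>
    ((compact K \<and> convex K \<and>
      convex hull {(0,0), (1,0), (0,1)} \<subseteq> K \<and> K \<subseteq> {0..1} \<times> {0..1}) \<and>
     (\<forall>A\<in>sets \<sigma>. emeasure \<sigma> A = length_measure (flipset K) A))"
proof -
  interpret S: angular_measure \<sigma>
    unfolding angular_measure_def angular_measure_axioms_def using assms by blast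
  have "spectral_measure_with_dependency_set \<sigma> K \<longleftrightarrow>
    sandwiched K \<and> (\<forall>A\<in>sets \<sigma>. emeasure \<sigma> A = length_measure (flipset K) A)"
  proof
    assume "spectral_measure_with_dependency_set \<sigma> K"
    then have mean: "(\<integral>a. fst a \<partial>\<sigma>) = 1" "(\<integral>a. snd a \<partial>\<sigma>) = 1" and dep: "is_dependency_set \<sigma> K"
      unfolding spectral_measure_with_dependency_set_def is_spectral_measure_def by auto
    have K: "sandwiched K"
      by (rule dependency_set_sandwiched[OF S.angular_measure_axioms mean dep])
    obtain \<tau> where \<tau>: "angular_measure \<tau>" "\<forall>A\<in>sets \<tau>. emeasure \<tau> A = length_measure (flipset K) A"
      "\<And>s t. 0 \<le> s \<Longrightarrow> 0 \<le> t \<Longrightarrow> support_fun K (s, t) = (\<integral>a. max (fst a * s) (snd a * t) \<partial>\<tau>)"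
      using ex_normal_measure[OF K] by blast
    have "support_fun K (s, t) = (\<integral>a. max (fst a * s) (snd a * t) \<partial>\<sigma>)" if "0 \<le> s" "0 \<le> t" for s t
      using dep that unfolding is_dependency_set_def orthant_def by auto
    then have "\<sigma> = \<tau>"
      using \<tau>(3) by (intro angular_measure_eqI[OF S.angular_measure_axioms \<tau>(1)]) metis
    then show "sandwiched K \<and> (\<forall>A\<in>sets \<sigma>. emeasure \<sigma> A = length_measure (flipset K) A)"
      using K \<tau>(2) by blast
  next
    assume asm: "sandwiched K \<and> (\<forall>A\<in>sets \<sigma>. emeasure \<sigma> A = length_measure (flipset K) A)"
    then have K: "sandwiched K" by blast
    obtain \<tau> where \<tau>: "angular_measure \<tau>" "\<forall>A\<in>sets \<tau>. emeasure \<tau> A = length_measure (flipset K) A"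
      "\<And>s t. 0 \<le> s \<Longrightarrow> 0 \<le> t \<Longrightarrow> support_fun K (s, t) = (\<integral>a. max (fst a * s) (snd a * t) \<partial>\<tau>)"
      using ex_normal_measure[OF K] by blast
    have "\<sigma> = \<tau>"
      using asm \<tau>(2) angular_measure.sets_eq[OF \<tau>(1)] by (intro measure_eqI) (auto simp: S.sets_eq)
    then have sup: "support_fun K (s, t) = (\<integral>a. max (fst a * s) (snd a * t) \<partial>\<sigma>)" if "0 \<le> s" "0 \<le> t" for s t
      using \<tau>(3) that by blast
    have K': "compact K" "convex K" "K \<subseteq> {0..1} \<times> {0..1}" "(1,0) \<in> K" "(0,1) \<in> K"
      using K convex_hull_corners_subset_iff[of K] by (auto simp: sandwiched_def)
    \<comment> \<open>The inclusions of the corners in \<open>K\<close> and of \<open>K\<close> in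
      the square give value 1 in the axis directions; these values are the means of
      \<sigma>.\<close>
    have "support_fun K (1, 0) \<le> 1" "support_fun K (0, 1) \<le> 1"
      using K' by (intro support_fun_le; auto)+
    moreover have "1 \<le> support_fun K (1, 0)" "1 \<le> support_fun K (0, 1)"
      using inner_le_support_fun[OF K'(1,4), of "(1,0)"] inner_le_support_fun[OF K'(1,5), of "(0,1)"] by auto
    ultimately have mean: "(\<integral>a. fst a \<partial>\<sigma>) = 1" "(\<integral>a. snd a \<partial>\<sigma>) = 1"
      unfolding S.integral_fst_eq_max S.integral_snd_eq_max using sup[of 1 0] sup[of 0 1] by auto
    interpret spectral_angular \<sigma>
      by unfold_locales (fact mean)+
    have "is_dependency_set \<sigma> K"
      unfolding is_dependency_set_def
    proof (intro conjI allI impI ballI)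
      show "K \<subseteq> orthant" using K'(3) by (fastforce simp: orthant_def)
      fix L assume "compact L \<and> convex L \<and> L \<noteq> {} \<and> L \<subseteq> orthant \<and> (\<forall>x\<in>orthant. support_fun L x = support_fun K x)"
      then show "L \<subseteq> K" by (intro sandwiched_maximal[OF K]) auto
    qed (use K' sup in \<open>auto simp: orthant_def\<close>)
    then show "spectral_measure_with_dependency_set \<sigma> K"
      unfolding spectral_measure_with_dependency_set_def using ex_simple_max_stable by blast
  qed
  then show ?thesis by (simp add: sandwiched_def)
qed

end
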